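(* There exists an initial segment of the Dyment-Muchnik lattice $\mathscr{M}_{D,w}$ modeling exactly the intuitionistic propositional calculus; that is, there is $\mathbf{Z}\in\mathscr{M}_{D,w}$, $\mathbf{Z}\neq\mathbf{0}_{D,w}$, such that $\operatorname{Th}\big([\mathbf{0}_{D,w},\mathbf{Z}]_{\mathscr{M}_{D,w}}\big)=\mathrm{IPC}$.
   Context: $\mathcal{P}$ is the set of all partial functions from $\omega$ to $\omega$. An enumeration operator is a map $\Phi:2^\omega\to 2^\omega$ given by a c.e. set $W$ via $\Phi(A)=\{x:(\exists u)[\langle x,u\rangle\in W\ \&\ D_u\subseteq A]\}$, $D_u$ being the finite set with canonical index $u$. $A\le_e B$ iff $A=\Phi(B)$ for some enumeration operator $\Phi$. For partial functions, $\varphi\le_e\psi$ iff $\operatorname{graph}(\varphi)\le_e\operatorname{graph}(\psi)$. A $D$-mass problem is a subset of $\mathcal{P}$. $\mathcal{A}\le_{D,w}\mathcal{B}$ iff $(\forall\psi\in\mathcal{B})(\exists\varphi\in\mathcal{A})[\varphi\le_e\psi]$. The Dyment-Muchnik lattice $\mathscr{M}_{D,w}$ is the set of equivalence classes $[\mathcal{A}]_{D,w}$ of $D$-mass problems under the induced equivalence, ordered by $\le_{D,w}$; it is a Brouwer algebra with least element $\mathbf{0}_{D,w}$ (the class of any $D$-mass problem containing a partial computable function) and greatest element $\mathbf{1}_{D,w}=[\emptyset]_{D,w}$. A Brouwer algebra is a lattice with $0\neq 1$ (least and greatest elements) such that for all $a,b$ the set $\{c: a\lor c\ge b\}$ has a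 least element, denoted $a\to b$. For $a\ne 0$, the interval $[0,a]_{\mathscr{L}}$ of a Brouwer algebra $\mathscr{L}$ is again a Brouwer algebra, with greatest element $a$. A propositional formula is an identity of a Brouwer algebra if every assignment of elements to its atoms evaluates it to $0$, where the connectives $\lor,\wedge,\to$ are interpreted by meet, join, and $\to$ respectively, and $\neg a$ by $a\to 1$ (with $1$ the greatest element of the algebra). $\operatorname{Th}(\mathscr{L})$ is the set of identities of $\mathscr{L}$. $\mathrm{IPC}$ is the set of theorems of the intuitionistic propositional calculus. *)

theory Defs
  imports "HOL-Algebra.Lattice" "HOL-Library.Nat_Bijection"
begin

section \<open>Computably enumerable sets\<close>

text \<open>
  Kleene's partial recursive functions. Arities are not tracked: a missing argument makes the
  result undefined and a superfluous one is ignored, so every program denotes, at each arity,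
  a partial recursive function in the usual sense.
\<close>

datatype recf =
    Zero
  | Succ
  | Proj nat
  | Comp recf "recf list"
  | PrimRec recf recf
  | Mu recf

fun recf_eval :: "recf \<Rightarrow> nat list \<Rightarrow> nat option" where
  "recf_eval Zero xs = Some 0"
| "recf_eval Succ xs = (case xs of [] \<Rightarrow> None | x # _ \<Rightarrow> Some (Suc x))"
| "recf_eval (Proj i) xs = (if i < length xs then Some (xs ! i) else None)"
| "recf_eval (Comp f gs) xs =
     (if \<forall>g \<in> set gs. recf_eval g xs \<noteq> None
      then recf_eval f (map (\<lambda>g. the (recf_eval g xs)) gs)
      else None)"
| "recf_eval (PrimRec f g) xs =
     (case xs of
        [] \<Rightarrow> None
      | n # ys \<Rightarrow> rec_nat (recf_eval f ys)
          (\<lambda>m r. case r of None \<Rightarrow> None | Some v \<Rightarrow> recf_eval g (m # v # ys)) n)"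
| "recf_eval (Mu f) xs =
     (if \<exists>n. recf_eval f (n # xs) = Some 0 \<and> (\<forall>m<n. recf_eval f (m # xs) \<noteq> None)
      then Some (LEAST n. recf_eval f (n # xs) = Some 0)
      else None)"

definition comp_enum :: "nat set \<Rightarrow> bool" where
  "comp_enum W \<longleftrightarrow> (\<exists>p. W = {x. recf_eval p [x] \<noteq> None})"


section \<open>Enumeration reducibility\<close>

text \<open>
  \<^const>\<open>prod_encode\<close> is Cantor's pairing function, and
  \<^term>\<open>set_decode u\<close> is the finite set with canonical index \<^term>\<open>u\<close>,
  i.e. the set of positions of the digit 1 in the binary expansion of \<^term>\<open>u\<close>.
\<close>

definition enum_op :: "nat set \<Rightarrow> nat set \<Rightarrow> nat set" where
  "enum_op W A = {x. \<exists>u. prod_encode (x, u) \<in> W \<and> set_decode u \<subseteq> A}"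

definition enumeration_operator :: "(nat set \<Rightarrow> nat set) \<Rightarrow> bool" where
  "enumeration_operator \<Phi> \<longleftrightarrow> (\<exists>W. comp_enum W \<and> \<Phi> = enum_op W)"

definition enum_le :: "nat set \<Rightarrow> nat set \<Rightarrow> bool" (infix "\<le>\<^sub>e" 50) where
  "A \<le>\<^sub>e B \<longleftrightarrow> (\<exists>\<Phi>. enumeration_operator \<Phi> \<and> A = \<Phi> B)"

definition pfun_enum_le :: "(nat \<rightharpoonup> nat) \<Rightarrow> (nat \<rightharpoonup> nat) \<Rightarrow> bool" where
  "pfun_enum_le \<phi> \<psi> \<longleftrightarrow> prod_encode ` Map.graph \<phi> \<le>\<^sub>e prod_encode ` Map.graph \<psi>"


section \<open>The Dyment-Muchnik lattice\<close>

type_synonym D_mass_problem = "(nat \<rightharpoonup> nat) set"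

definition Dw_le :: "D_mass_problem \<Rightarrow> D_mass_problem \<Rightarrow> bool" where
  "Dw_le A B \<longleftrightarrow> (\<forall>\<psi>\<in>B. \<exists>\<phi>\<in>A. pfun_enum_le \<phi> \<psi>)"

definition Dw_equiv :: "(D_mass_problem \<times> D_mass_problem) set" where
  "Dw_equiv = {(A, B). Dw_le A B \<and> Dw_le B A}"

definition M_Dw :: "D_mass_problem set gorder" where
  "M_Dw = \<lparr>carrier = UNIV // Dw_equiv,
           eq = (=),
           le = (\<lambda>X Y. \<exists>A\<in>X. \<exists>B\<in>Y. Dw_le A B)\<rparr>"


section \<open>Brouwer algebras\<close>

locale brouwer_algebra = bounded_lattice +
  assumes bottom_neq_top: "\<bottom> \<noteq> \<top>"
    and imp_exists: "\<lbrakk>a \<in> carrier L; b \<in> carrier L\<rbrakk>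
      \<Longrightarrow> \<exists>x. least L x {c \<in> carrier L. b \<sqsubseteq> a \<squnion> c}"

definition brouwer_imp :: "('a, 'b) gorder_scheme \<Rightarrow> 'a \<Rightarrow> 'a \<Rightarrow> 'a" where
  "brouwer_imp L a b = (SOME x. least L x {c \<in> carrier L. b \<sqsubseteq>\<^bsub>L\<^esub> a \<squnion>\<^bsub>L\<^esub> c})"

definition initial_segment :: "'a gorder \<Rightarrow> 'a \<Rightarrow> 'a gorder" where
  "initial_segment L z = L\<lparr>carrier := \<lbrace>\<bottom>\<^bsub>L\<^esub>..z\<rbrace>\<^bsub>L\<^esub>\<rparr>"


section \<open>Intuitionistic propositional calculus\<close>

datatype form =
    Atom nat
  | Neg form
  | Or form form
  | And form form
  | Imp form form

text \<open>Kleene's Hilbert-style axiomatization.\<close>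

inductive_set IPC :: "form set" where
  K: "Imp A (Imp B A) \<in> IPC"
| S: "Imp (Imp A (Imp B C)) (Imp (Imp A B) (Imp A C)) \<in> IPC"
| AndI: "Imp A (Imp B (And A B)) \<in> IPC"
| AndE1: "Imp (And A B) A \<in> IPC"
| AndE2: "Imp (And A B) B \<in> IPC"
| OrI1: "Imp A (Or A B) \<in> IPC"
| OrI2: "Imp B (Or A B) \<in> IPC"
| OrE: "Imp (Imp A C) (Imp (Imp B C) (Imp (Or A B) C)) \<in> IPC"
| NegI: "Imp (Imp A B) (Imp (Imp A (Neg B)) (Neg A)) \<in> IPC"
| NegE: "Imp (Neg A) (Imp A B) \<in> IPC"
| MP: "\<lbrakk>Imp A B \<in> IPC; A \<in> IPC\<rbrakk> \<Longrightarrow> B \<in> IPC"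

text \<open>Truth is the least element, so disjunction is the meet and conjunction is the join.\<close>

primrec form_eval :: "('a, 'b) gorder_scheme \<Rightarrow> (nat \<Rightarrow> 'a) \<Rightarrow> form \<Rightarrow> 'a" where
  "form_eval L v (Atom n) = v n"
| "form_eval L v (Neg A) = brouwer_imp L (form_eval L v A) \<top>\<^bsub>L\<^esub>"
| "form_eval L v (Or A B) = form_eval L v A \<sqinter>\<^bsub>L\<^esub> form_eval L v B"
| "form_eval L v (And A B) = form_eval L v A \<squnion>\<^bsub>L\<^esub> form_eval L v B"
| "form_eval L v (Imp A B) = brouwer_imp L (form_eval L v A) (form_eval L v B)"

definition Th :: "('a, 'b) gorder_scheme \<Rightarrow> form set" where
  "Th L = {A. \<forall>v. range v \<subseteq> carrier L \<longrightarrow> form_eval L v A = \<bottom>\<^bsub>L\<^esub>}"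

end

theory Submission
  imports Defs "HOL-Library.Sublist" "HOL-Library.Countable_Set"
begin

text \<open>
  Weak reducibility of \<open>D\<close>-mass problems compares upward closures under \<open>\<le>\<^sub>e\<close>, so the
  Dyment-Muchnik lattice is the lattice of up-sets of partial functions ordered by reverse inclusion
  (\<open>carrier_M_Dw\<close>, \<open>le_M_Dw\<close>). If \<open>Z\<close> is an up-set, then the initial segment below its class consists of
  the up-sets including \<open>Z\<close>, that is, of the up-sets of the Kripke frame formed by the complement \<open>P\<close> of
  \<open>Z\<close>, and evaluating a formula in it amounts to forcing on that frame (\<open>Th_eq_forced\<close>). Any nonempty
  \<open>\<le>\<^sub>e\<close>-downward closed \<open>P\<close> can occur. Soundness being general, one has to find a \<open>P\<close> on which every
  formula outside \<open>IPC\<close> is refuted.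

  Such a formula is refuted at a world of a finite frame (\<open>finite_countermodel\<close>), and the part of a
  countable frame above a world is a p-morphic image of the tree of finite sequences of numbers
  (\<open>p_morphism_from_sequences\<close>). It therefore suffices that \<open>P\<close> maps
  p-morphically onto that tree. Let \<open>d\<close> be an order embedding of the tree into the partial functions under
  \<open>\<le>\<^sub>e\<close> such that everything below both \<open>d \<sigma>\<close> and \<open>d \<tau>\<close> is below the image of the longest common prefix
  of \<open>\<sigma>\<close> and \<open>\<tau>\<close>, and let \<open>P\<close> be the downward closure of the range of \<open>d\<close>. Then each member of \<open>P\<close> is
  below \<open>d \<sigma>\<close> for a least \<open>\<sigma>\<close>, and sending it to this \<open>\<sigma>\<close> is the desired p-morphism
  (\<open>p_morphism_to_tree\<close>).

  The embedding (\<open>enum_degree_tree\<close>) comes from one sufficiently generic set whose columns are indexed by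
  the nodes of the tree: \<open>d \<sigma>\<close> is the part in the columns of the initial segments of \<open>\<sigma>\<close>. That what two
  finite families of columns enumerate in common is already enumerated by their common columns is the
  forcing argument \<open>generic_meet\<close>. It uses only that there are countably many enumeration operators, all
  monotone and finitary. Computability proper enters through the transitivity of \<open>\<le>\<^sub>e\<close>
  (\<open>enum_le_trans\<close>) and the fact that c.e. information can be added to, or used as a filter on, an oracle
  (\<open>comp_enum_Un_Int_enum_le\<close>); both rest on the characterization of c.e. sets as the projections of
  decidable relations (\<open>comp_enum_iff_semidecidable\<close>).
\<close>


section \<open>Total recursive functions\<close>

definition computable :: "nat \<Rightarrow> (nat list \<Rightarrow> nat) \<Rightarrow> bool" where
  "computable n f \<longleftrightarrow> (\<exists>p. \<forall>xs. length xs = n \<longrightarrow> recf_eval p xs = Some (f xs))"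

text \<open>
  Functions to lists of a fixed length: they make composition a single rule, in which rearranging,
  dropping and duplicating arguments are all instances of the inner function.
\<close>
definition computable_list :: "nat \<Rightarrow> nat \<Rightarrow> (nat list \<Rightarrow> nat list) \<Rightarrow> bool" where
  "computable_list n m F \<longleftrightarrow>
     (\<forall>xs. length xs = n \<longrightarrow> length (F xs) = m) \<and> (\<forall>i<m. computable n (\<lambda>xs. F xs ! i))"

lemma computable_cong:
  assumes "\<And>xs. length xs = n \<Longrightarrow> f xs = g xs" "computable n g"
  shows "computable n f"
  using assms unfolding computable_def by metis

lemma computable_compose:
  assumes "computable m f" "computable_list n m F"
  shows "computable n (\<lambda>xs. f (F xs))"
proof -
  obtain p where p: "\<And>xs. length xs = m \<Longrightarrow> recf_eval p xs = Some (f xs)"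
    using assms(1) unfolding computable_def by blast
  have "\<forall>i<m. \<exists>q. \<forall>xs. length xs = n \<longrightarrow> recf_eval q xs = Some (F xs ! i)"
    using assms(2) unfolding computable_list_def computable_def by blast
  then obtain q where q: "\<And>i xs. i < m \<Longrightarrow> length xs = n \<Longrightarrow> recf_eval (q i) xs = Some (F xs ! i)"
    by metis
  have "recf_eval (Comp p (map q [0..<m])) xs = Some (f (F xs))" if "length xs = n" for xs
  proof -
    have len: "length (F xs) = m"
      using assms(2) that unfolding computable_list_def by blast
    have "map (\<lambda>i. the (recf_eval (q i) xs)) [0..<m] = map (\<lambda>i. F xs ! i) [0..<m]"
      using q that by (intro map_cong) auto
    also have "\<dots> = F xs"
      using len map_nth[of "F xs"] by simp
    finally show ?thesis
      using q that p len by (simp add: comp_def)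
  qed
  then show ?thesis
    unfolding computable_def by blast
qed

lemma computable_nth: "i < n \<Longrightarrow> computable n (\<lambda>xs. xs ! i)"
  unfolding computable_def by (rule exI[of _ "Proj i"]) simp

lemma computable_list_id: "computable_list n n (\<lambda>xs. xs)"
  unfolding computable_list_def using computable_nth by auto

lemma computable_list_Nil: "computable_list n 0 (\<lambda>xs. [])"
  unfolding computable_list_def by auto

lemma computable_list_Cons:
  assumes "computable n f" "computable_list n m F"
  shows "computable_list n (Suc m) (\<lambda>xs. f xs # F xs)"
  using assms unfolding computable_list_def by (auto simp: less_Suc_eq_0_disj)

lemma computable_list_tl:
  assumes "computable_list n (Suc m) F"
  shows "computable_list n m (\<lambda>xs. tl (F xs))"
  unfolding computable_list_def
proof (intro conjI allI impI)
  fix i assume "i < m"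
  moreover have "computable n (\<lambda>xs. F xs ! Suc i)"
    using assms \<open>i < m\<close> unfolding computable_list_def by auto
  moreover have "length (F xs) = Suc m" if "length xs = n" for xs
    using assms that unfolding computable_list_def by blast
  ultimately show "computable n (\<lambda>xs. tl (F xs) ! i)"
    by (auto intro!: computable_cong[where g = "\<lambda>xs. F xs ! Suc i"] simp: nth_tl)
qed (use assms in \<open>auto simp: computable_list_def\<close>)

lemma computable_hd:
  assumes "computable_list n (Suc m) F"
  shows "computable n (\<lambda>xs. hd (F xs))"
proof (rule computable_cong)
  show "hd (F xs) = F xs ! 0" if "length xs = n" for xs
    using assms that unfolding computable_list_def
    by (metis hd_conv_nth list.size(3) nat.distinct(1))
  show "computable n (\<lambda>xs. F xs ! 0)"
    using assms unfolding computable_list_def by blast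
qed

lemma computable_Suc:
  assumes "computable n f"
  shows "computable n (\<lambda>xs. Suc (f xs))"
proof -
  have "computable (Suc 0) (\<lambda>xs. Suc (hd xs))"
    unfolding computable_def by (rule exI[of _ Succ]) (auto simp: length_Suc_conv)
  then have "computable n (\<lambda>xs. Suc (hd [f xs]))"
    by (rule computable_compose) (intro computable_list_Cons computable_list_Nil assms)
  then show ?thesis by simp
qed

lemma computable_const: "computable n (\<lambda>xs. c)"
proof (induction c)
  case 0
  show ?case unfolding computable_def by (rule exI[of _ Zero]) simp
next
  case (Suc c)
  then show ?case by (rule computable_Suc)
qed

text \<open>
  The step function \<open>g\<close> takes the stage, the previous value and the parameters; binding them by
  \<^const>\<open>hd\<close> and \<^const>\<open>tl\<close> keeps the rule applicable by higher-order pattern unification.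
\<close>
lemma computable_rec:
  assumes b: "computable n b" and f: "computable n f"
    and g: "computable (Suc (Suc n)) (\<lambda>ys. g (hd ys) (hd (tl ys)) (tl (tl ys)))"
  shows "computable n (\<lambda>xs. rec_nat (f xs) (\<lambda>m r. g m r xs) (b xs))"
proof -
  obtain p where p: "\<And>xs. length xs = n \<Longrightarrow> recf_eval p xs = Some (f xs)"
    using f unfolding computable_def by blast
  obtain q where q: "\<And>ys. length ys = Suc (Suc n) \<Longrightarrow>
      recf_eval q ys = Some (g (hd ys) (hd (tl ys)) (tl (tl ys)))"
    using g unfolding computable_def by blast
  have step: "rec_nat (Some (f xs))
      (\<lambda>m r. case r of None \<Rightarrow> None | Some v \<Rightarrow> recf_eval q (m # v # xs)) k
      = Some (rec_nat (f xs) (\<lambda>m r. g m r xs) k)" if "length xs = n" for xs k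
    using that by (induction k) (auto simp: q)
  have "recf_eval (PrimRec p q) ys = Some (rec_nat (f (tl ys)) (\<lambda>m r. g m r (tl ys)) (hd ys))"
    if "length ys = Suc n" for ys
    using that by (cases ys) (auto simp: p step)
  then have "computable (Suc n) (\<lambda>ys. rec_nat (f (tl ys)) (\<lambda>m r. g m r (tl ys)) (hd ys))"
    unfolding computable_def by blast
  then have "computable n (\<lambda>xs. rec_nat (f (tl (b xs # xs))) (\<lambda>m r. g m r (tl (b xs # xs))) (hd (b xs # xs)))"
    by (rule computable_compose) (intro computable_list_Cons b computable_list_id)
  then show ?thesis by simp
qed

lemmas computable_basic =
  computable_list_Nil computable_list_Cons computable_Suc computable_const
  computable_list_id
  computable_list_tl[OF computable_list_id]
  computable_list_tl[OF computable_list_tl[OF computable_list_id]]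
  computable_list_tl[OF computable_list_tl[OF computable_list_tl[OF computable_list_id]]]
  computable_list_tl[OF computable_list_tl[OF computable_list_tl[OF computable_list_tl[OF computable_list_id]]]]
  computable_hd[OF computable_list_id]
  computable_hd[OF computable_list_tl[OF computable_list_id]]
  computable_hd[OF computable_list_tl[OF computable_list_tl[OF computable_list_id]]]
  computable_hd[OF computable_list_tl[OF computable_list_tl[OF computable_list_tl[OF computable_list_id]]]]
  computable_hd[OF computable_list_tl[OF computable_list_tl[OF computable_list_tl[OF computable_list_tl[OF computable_list_id]]]]]

lemma computable_binary:
  assumes h: "computable (Suc (Suc 0)) (\<lambda>ys. h (hd ys) (hd (tl ys)))"
    and f: "computable n f" and g: "computable n g"
  shows "computable n (\<lambda>xs. h (f xs) (g xs))"
proof -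
  have "computable n (\<lambda>xs. h (hd [f xs, g xs]) (hd (tl [f xs, g xs])))"
    by (rule computable_compose[OF h]) (intro computable_basic f g)
  then show ?thesis by simp
qed

lemma computable_add:
  assumes "computable n f" "computable n g"
  shows "computable n (\<lambda>xs. f xs + g xs)"
proof (rule computable_cong)
  show "computable n (\<lambda>xs. rec_nat (f xs) (\<lambda>m r. Suc r) (g xs))"
    by (intro computable_rec computable_basic assms)
  have "a + k = rec_nat a (\<lambda>m r. Suc r) k" for a k :: nat
    by (induction k) auto
  then show "f xs + g xs = rec_nat (f xs) (\<lambda>m r. Suc r) (g xs)" for xs .
qed

lemma computable_pred:
  assumes "computable n f"
  shows "computable n (\<lambda>xs. f xs - 1)"
proof (rule computable_cong)
  show "computable n (\<lambda>xs. rec_nat 0 (\<lambda>m r. m) (f xs))"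
    by (intro computable_rec computable_basic assms)
  show "f xs - 1 = rec_nat 0 (\<lambda>m r. m) (f xs)" for xs
    by (cases "f xs") auto
qed

lemma computable_diff:
  assumes "computable n f" "computable n g"
  shows "computable n (\<lambda>xs. f xs - g xs)"
proof (rule computable_cong)
  show "computable n (\<lambda>xs. rec_nat (f xs) (\<lambda>m r. r - 1) (g xs))"
    by (intro computable_rec computable_pred computable_basic assms)
  have "a - k = rec_nat a (\<lambda>m r. r - 1) k" for a k :: nat
    by (induction k) auto
  then show "f xs - g xs = rec_nat (f xs) (\<lambda>m r. r - 1) (g xs)" for xs .
qed

lemma computable_mult:
  assumes "computable n f" "computable n g"
  shows "computable n (\<lambda>xs. f xs * g xs)"
proof (rule computable_binary[OF computable_cong assms])
  show "computable (Suc (Suc 0)) (\<lambda>ys. rec_nat 0 (\<lambda>m r. r + hd ys) (hd (tl ys)))"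
    by (intro computable_rec computable_add computable_basic)
  have "a * k = rec_nat 0 (\<lambda>m r. r + a) k" for a k :: nat
    by (induction k) auto
  then show "hd ys * hd (tl ys) = rec_nat 0 (\<lambda>m r. r + hd ys) (hd (tl ys))" for ys :: "nat list" .
qed

lemma computable_power2:
  assumes "computable n f"
  shows "computable n (\<lambda>xs. 2 ^ f xs)"
proof (rule computable_cong)
  show "computable n (\<lambda>xs. rec_nat 1 (\<lambda>m r. r + r) (f xs))"
    by (intro computable_rec computable_add computable_basic assms)
  have "2 ^ k = rec_nat (1::nat) (\<lambda>m r. r + r) k" for k
    by (induction k) auto
  then show "2 ^ f xs = rec_nat (1::nat) (\<lambda>m r. r + r) (f xs)" for xs .
qed

lemma computable_prod_encode:
  assumes "computable n f" "computable n g"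
  shows "computable n (\<lambda>xs. prod_encode (f xs, g xs))"
proof (rule computable_cong)
  show "computable n (\<lambda>xs. rec_nat 0 (\<lambda>m r. r + Suc m) (f xs + g xs) + f xs)"
    by (intro computable_rec computable_add computable_basic assms)
  have "triangle k = rec_nat 0 (\<lambda>m r. r + Suc m) k" for k
    by (induction k) auto
  then show "prod_encode (f xs, g xs) = rec_nat 0 (\<lambda>m r. r + Suc m) (f xs + g xs) + f xs" for xs
    by (simp add: prod_encode_def)
qed

lemma computable_sum:
  assumes b: "computable n b" and f: "computable (Suc n) (\<lambda>ys. f (hd ys) (tl ys))"
  shows "computable n (\<lambda>xs. \<Sum>y<b xs. f y xs)"
proof (rule computable_cong)
  have "computable (Suc (Suc n)) (\<lambda>ys. (\<lambda>zs. f (hd zs) (tl zs)) (hd ys # tl (tl ys)))"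
    by (rule computable_compose[OF f]) (intro computable_basic)
  then have "computable (Suc (Suc n)) (\<lambda>ys. f (hd ys) (tl (tl ys)))"
    by simp
  then show "computable n (\<lambda>xs. rec_nat 0 (\<lambda>m r. r + f m xs) (b xs))"
    by (intro computable_rec computable_add computable_basic b)
  have "(\<Sum>y<k. f y xs) = rec_nat 0 (\<lambda>m r. r + f m xs) k" for k xs
    by (induction k) auto
  then show "(\<Sum>y<b xs. f y xs) = rec_nat 0 (\<lambda>m r. r + f m xs) (b xs)" for xs .
qed


section \<open>Decidable and semidecidable relations\<close>

text \<open>
  Truth is coded by \<open>0\<close>, so that unbounded search for a witness is \<^const>\<open>Mu\<close> applied to the program.
\<close>
definition decidable :: "nat \<Rightarrow> (nat list \<Rightarrow> bool) \<Rightarrow> bool" where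
  "decidable n P \<longleftrightarrow> computable n (\<lambda>xs. if P xs then 0 else 1)"

lemma decidable_cong:
  assumes "\<And>xs. length xs = n \<Longrightarrow> P xs \<longleftrightarrow> Q xs" "decidable n Q"
  shows "decidable n P"
  using assms unfolding decidable_def by (auto elim: computable_cong[rotated])

lemma decidable_compose:
  assumes "decidable m P" "computable_list n m F"
  shows "decidable n (\<lambda>xs. P (F xs))"
  using assms computable_compose[of m "\<lambda>xs. if P xs then 0 else 1"] unfolding decidable_def by simp

lemma decidable_zero:
  assumes "computable n f"
  shows "decidable n (\<lambda>xs. f xs = 0)"
  unfolding decidable_def
proof (rule computable_cong)
  show "computable n (\<lambda>xs. rec_nat 0 (\<lambda>m r. 1) (f xs))"
    by (intro computable_rec computable_basic assms)
  show "(if f xs = 0 then 0 else 1) = rec_nat 0 (\<lambda>m r. 1) (f xs)" for xs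
    by (cases "f xs") auto
qed

lemma decidable_less:
  assumes "computable n f" "computable n g"
  shows "decidable n (\<lambda>xs. f xs < g xs)"
  by (rule decidable_cong[OF _ decidable_zero[OF computable_diff[OF computable_Suc[OF assms(1)] assms(2)]]])
    auto

lemma decidable_eq:
  assumes "computable n f" "computable n g"
  shows "decidable n (\<lambda>xs. f xs = g xs)"
  by (rule decidable_cong[OF _ decidable_zero[OF computable_add[OF
          computable_diff[OF assms] computable_diff[OF assms(2,1)]]]]) auto

lemma decidable_conj:
  assumes "decidable n P" "decidable n Q"
  shows "decidable n (\<lambda>xs. P xs \<and> Q xs)"
  by (rule decidable_cong[OF _ decidable_zero[OF computable_add[OF assms[unfolded decidable_def]]]]) auto

lemma decidable_not:
  assumes "decidable n P"
  shows "decidable n (\<lambda>xs. \<not> P xs)"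
  by (rule decidable_cong[OF _ decidable_zero[OF computable_diff[OF computable_const[of n 1]
            assms[unfolded decidable_def]]]]) auto

lemma decidable_imp:
  assumes "decidable n P" "decidable n Q"
  shows "decidable n (\<lambda>xs. P xs \<longrightarrow> Q xs)"
  by (rule decidable_cong[OF _ decidable_not[OF decidable_conj[OF assms(1) decidable_not[OF assms(2)]]]]) auto

lemma decidable_disj:
  assumes "decidable n P" "decidable n Q"
  shows "decidable n (\<lambda>xs. P xs \<or> Q xs)"
  by (rule decidable_cong[OF _ decidable_imp[OF decidable_not[OF assms(1)] assms(2)]]) auto

lemma decidable_all_less:
  assumes "computable n b" "decidable (Suc n) (\<lambda>ys. P (hd ys) (tl ys))"
  shows "decidable n (\<lambda>xs. \<forall>y<b xs. P y xs)"
proof (rule decidable_cong)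
  show "decidable n (\<lambda>xs. (\<Sum>y<b xs. if P y xs then 0 else (1::nat)) = 0)"
    by (intro decidable_zero computable_sum assms(1) assms(2)[unfolded decidable_def])
qed auto

lemma decidable_ex_less:
  assumes "computable n b" "decidable (Suc n) (\<lambda>ys. P (hd ys) (tl ys))"
  shows "decidable n (\<lambda>xs. \<exists>y<b xs. P y xs)"
  by (rule decidable_cong[OF _ decidable_not[OF decidable_all_less[OF assms(1) decidable_not[OF assms(2)]]]]) auto

lemma computable_if:
  assumes "decidable n P" "computable n f" "computable n g"
  shows "computable n (\<lambda>xs. if P xs then f xs else g xs)"
proof (rule computable_cong)
  show "computable n (\<lambda>xs. f xs * (1 - (if P xs then 0 else 1)) + g xs * (if P xs then 0 else 1))"
    by (intro computable_add computable_mult computable_diff computable_const assms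
        assms(1)[unfolded decidable_def])
qed auto

definition semidecidable :: "nat \<Rightarrow> (nat list \<Rightarrow> bool) \<Rightarrow> bool" where
  "semidecidable n R \<longleftrightarrow>
     (\<exists>P. decidable (Suc n) P \<and> (\<forall>xs. length xs = n \<longrightarrow> (R xs \<longleftrightarrow> (\<exists>s. P (s # xs)))))"

lemma semidecidableI:
  assumes "decidable (Suc n) (\<lambda>ys. P (hd ys) (tl ys))"
    "\<And>xs. length xs = n \<Longrightarrow> R xs \<longleftrightarrow> (\<exists>s. P s xs)"
  shows "semidecidable n R"
  unfolding semidecidable_def
  by (rule exI[of _ "\<lambda>ys. P (hd ys) (tl ys)"]) (use assms in auto)

lemma semidecidable_decidable:
  assumes "decidable n P"
  shows "semidecidable n P"
  by (rule semidecidableI[where P = "\<lambda>s. P"])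
    (auto intro!: decidable_compose[OF assms] computable_basic)

lemma semidecidable_compose:
  assumes "semidecidable m R" "computable_list n m F"
  shows "semidecidable n (\<lambda>xs. R (F xs))"
proof -
  obtain P where P: "decidable (Suc m) P" "\<And>xs. length xs = m \<Longrightarrow> R xs \<longleftrightarrow> (\<exists>s. P (s # xs))"
    using assms(1) unfolding semidecidable_def by blast
  have "computable_list (Suc n) m (\<lambda>ys. F (tl ys))"
    using assms(2) computable_compose[OF _ computable_list_tl[OF computable_list_id]]
    unfolding computable_list_def by fastforce
  then have "decidable (Suc n) (\<lambda>ys. P (hd ys # F (tl ys)))"
    by (intro decidable_compose[OF P(1)] computable_basic)
  moreover have "R (F xs) \<longleftrightarrow> (\<exists>s. P (s # F xs))" if "length xs = n" for xs
    using P(2) assms(2) that unfolding computable_list_def by blast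
  ultimately show ?thesis
    by (rule semidecidableI)
qed

lemma semidecidable_conj:
  assumes "semidecidable n R" "semidecidable n R'"
  shows "semidecidable n (\<lambda>xs. R xs \<and> R' xs)"
proof -
  obtain P where P: "decidable (Suc n) P" "\<And>xs. length xs = n \<Longrightarrow> R xs \<longleftrightarrow> (\<exists>s. P (s # xs))"
    using assms(1) unfolding semidecidable_def by blast
  obtain P' where P': "decidable (Suc n) P'" "\<And>xs. length xs = n \<Longrightarrow> R' xs \<longleftrightarrow> (\<exists>s. P' (s # xs))"
    using assms(2) unfolding semidecidable_def by blast
  have "decidable (Suc n) (\<lambda>ys. (\<exists>t<hd ys. P (t # tl ys)) \<and> (\<exists>t<hd ys. P' (t # tl ys)))"
    by (intro decidable_conj decidable_ex_less decidable_compose[OF P(1)] decidable_compose[OF P'(1)]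
        computable_basic)
  moreover have "R xs \<and> R' xs \<longleftrightarrow> (\<exists>s. (\<exists>t<s. P (t # xs)) \<and> (\<exists>t<s. P' (t # xs)))"
    if "length xs = n" for xs
  proof
    assume "R xs \<and> R' xs"
    then obtain t t' where "P (t # xs)" "P' (t' # xs)"
      using P(2) P'(2) \<open>length xs = n\<close> by blast
    then show "\<exists>s. (\<exists>t<s. P (t # xs)) \<and> (\<exists>t<s. P' (t # xs))"
      by (intro exI[of _ "Suc (t + t')"] conjI exI[of _ t] exI[of _ t']) auto
  qed (use P(2) P'(2) that in blast)
  ultimately show ?thesis
    by (rule semidecidableI)
qed

lemma semidecidable_disj:
  assumes "semidecidable n R" "semidecidable n R'"
  shows "semidecidable n (\<lambda>xs. R xs \<or> R' xs)"
proof -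
  obtain P where P: "decidable (Suc n) P" "\<And>xs. length xs = n \<Longrightarrow> R xs \<longleftrightarrow> (\<exists>s. P (s # xs))"
    using assms(1) unfolding semidecidable_def by blast
  obtain P' where P': "decidable (Suc n) P'" "\<And>xs. length xs = n \<Longrightarrow> R' xs \<longleftrightarrow> (\<exists>s. P' (s # xs))"
    using assms(2) unfolding semidecidable_def by blast
  have "decidable (Suc n) (\<lambda>ys. P (hd ys # tl ys) \<or> P' (hd ys # tl ys))"
    by (intro decidable_disj decidable_compose[OF P(1)] decidable_compose[OF P'(1)] computable_basic)
  then show ?thesis
    by (rule semidecidableI) (use P(2) P'(2) in auto)
qed

text \<open>
  Two nested searches, or a search below a bounded universal quantifier, are merged into a single
  search for a common bound of all witnesses; this avoids coding tuples.
\<close>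
lemma semidecidable_ex:
  assumes "semidecidable (Suc n) (\<lambda>ys. R (hd ys) (tl ys))"
  shows "semidecidable n (\<lambda>xs. \<exists>y. R y xs)"
proof -
  obtain P where P: "decidable (Suc (Suc n)) P"
    "\<And>ys. length ys = Suc n \<Longrightarrow> R (hd ys) (tl ys) \<longleftrightarrow> (\<exists>s. P (s # ys))"
    using assms unfolding semidecidable_def by blast
  have "decidable (Suc n) (\<lambda>ys. \<exists>y<hd ys. \<exists>t<hd ys. P (t # y # tl ys))"
    by (intro decidable_ex_less decidable_compose[OF P(1)] computable_basic)
  moreover have "(\<exists>y. R y xs) \<longleftrightarrow> (\<exists>s. \<exists>y<s. \<exists>t<s. P (t # y # xs))" if "length xs = n" for xs
  proof
    assume "\<exists>y. R y xs"
    then obtain y t where "P (t # y # xs)"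
      using P(2)[of "_ # xs"] \<open>length xs = n\<close> by auto
    then show "\<exists>s. \<exists>y<s. \<exists>t<s. P (t # y # xs)"
      by (intro exI[of _ "Suc (t + y)"] exI[of _ y] exI[of _ t] conjI) auto
  qed (use P(2)[of "_ # xs"] that in auto)
  ultimately show ?thesis
    by (rule semidecidableI)
qed

lemma semidecidable_all_less:
  assumes b: "computable n b" and "semidecidable (Suc n) (\<lambda>ys. R (hd ys) (tl ys))"
  shows "semidecidable n (\<lambda>xs. \<forall>y<b xs. R y xs)"
proof -
  obtain P where P: "decidable (Suc (Suc n)) P"
    "\<And>ys. length ys = Suc n \<Longrightarrow> R (hd ys) (tl ys) \<longleftrightarrow> (\<exists>s. P (s # ys))"
    using assms unfolding semidecidable_def by blast
  have "decidable (Suc n) (\<lambda>ys. \<forall>y<b (tl ys). \<exists>t<hd ys. P (t # y # tl ys))"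
    by (intro decidable_all_less decidable_ex_less decidable_compose[OF P(1)]
        computable_compose[OF b] computable_basic)
  moreover have "(\<forall>y<b xs. R y xs) \<longleftrightarrow> (\<exists>s. \<forall>y<b xs. \<exists>t<s. P (t # y # xs))" if "length xs = n" for xs
  proof
    assume "\<forall>y<b xs. R y xs"
    then have "\<forall>y<b xs. \<exists>t. P (t # y # xs)"
      using P(2)[of "_ # xs"] \<open>length xs = n\<close> by auto
    then obtain t where t: "\<And>y. y < b xs \<Longrightarrow> P (t y # y # xs)"
      by metis
    have "t y < Suc (Max (t ` {..<b xs}))" if "y < b xs" for y
      using that by (auto simp: less_Suc_eq_le)
    with t show "\<exists>s. \<forall>y<b xs. \<exists>t<s. P (t # y # xs)"
      by blast
  qed (use P(2)[of "_ # xs"] that in auto)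
  ultimately show ?thesis
    by (rule semidecidableI)
qed


section \<open>Computably enumerable sets are the semidecidable ones\<close>

text \<open>
  Evaluation with fuel \<open>s\<close>, the result \<open>v\<close> being reported as \<open>Suc v\<close> and failure as \<open>0\<close>. Fuel only
  bounds the searches of \<^const>\<open>Mu\<close>, so each clause is total recursive in \<open>s\<close> and the arguments. In the
  clause for \<^const>\<open>Mu\<close> at most one summand is nonzero, so the sum returns the value found.
\<close>
fun fuel_eval :: "nat \<Rightarrow> recf \<Rightarrow> nat list \<Rightarrow> nat" where
  "fuel_eval s Zero xs = 1"
| "fuel_eval s Succ xs = (case xs of [] \<Rightarrow> 0 | x # _ \<Rightarrow> Suc (Suc x))"
| "fuel_eval s (Proj i) xs = (if i < length xs then Suc (xs ! i) else 0)"
| "fuel_eval s (Comp f gs) xs =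
     (if \<forall>g\<in>set gs. fuel_eval s g xs \<noteq> 0
      then fuel_eval s f (map (\<lambda>g. fuel_eval s g xs - 1) gs) else 0)"
| "fuel_eval s (PrimRec f g) xs =
     (case xs of [] \<Rightarrow> 0
      | n # ys \<Rightarrow> rec_nat (fuel_eval s f ys)
          (\<lambda>m r. if r = 0 then 0 else fuel_eval s g (m # (r - 1) # ys)) n)"
| "fuel_eval s (Mu f) xs =
     (\<Sum>n<s. if fuel_eval s f (n # xs) = 1 \<and> (\<forall>m<n. 1 < fuel_eval s f (m # xs)) then Suc n else 0)"

lemma fuel_eval_sound: "fuel_eval s p xs = Suc v \<Longrightarrow> recf_eval p xs = Some v"
proof (induction p arbitrary: xs v)
  case (Comp f gs)
  have ne: "\<forall>g\<in>set gs. fuel_eval s g xs \<noteq> 0"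
    and ev: "fuel_eval s f (map (\<lambda>g. fuel_eval s g xs - 1) gs) = Suc v"
    using Comp.prems by (auto split: if_splits)
  have gs: "recf_eval g xs = Some (fuel_eval s g xs - 1)" if "g \<in> set gs" for g
    using Comp.IH(2)[OF that, of xs "fuel_eval s g xs - 1"] ne that by simp
  then have "map (\<lambda>g. the (recf_eval g xs)) gs = map (\<lambda>g. fuel_eval s g xs - 1) gs"
    by simp
  then have "recf_eval f (map (\<lambda>g. the (recf_eval g xs)) gs) = Some v"
    using Comp.IH(1)[OF ev] by (simp only:)
  then show ?case
    using gs by simp
next
  case (PrimRec f g)
  then obtain n ys where xs: "xs = n # ys"
    by (cases xs) auto
  have "rec_nat (recf_eval f ys) (\<lambda>m r. case r of None \<Rightarrow> None | Some v \<Rightarrow> recf_eval g (m # v # ys)) k = Some w"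
    if "rec_nat (fuel_eval s f ys) (\<lambda>m r. if r = 0 then 0 else fuel_eval s g (m # (r - 1) # ys)) k = Suc w" for k w
    using that
  proof (induction k arbitrary: w)
    case 0
    then show ?case using PrimRec.IH(1) by simp
  next
    case (Suc k)
    let ?r = "rec_nat (fuel_eval s f ys) (\<lambda>m r. if r = 0 then 0 else fuel_eval s g (m # (r - 1) # ys)) k"
    from Suc.prems have "?r \<noteq> 0" "fuel_eval s g (k # (?r - 1) # ys) = Suc w"
      by (auto split: if_splits)
    then show ?case using Suc.IH[of "?r - 1"] PrimRec.IH(2) by simp
  qed
  with PrimRec.prems show ?case unfolding xs by simp
next
  case (Mu f)
  \<comment> \<open>\<open>Q\<close> singles out the summand that the search stops at\<close>
  define Q where "Q n \<longleftrightarrow> fuel_eval s f (n # xs) = 1 \<and> (\<forall>m<n. 1 < fuel_eval s f (m # xs))" for n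
  have sum: "(\<Sum>n<s. if Q n then Suc n else 0) = Suc v"
    using Mu.prems unfolding Q_def by simp
  have "\<exists>n<s. Q n"
  proof (rule ccontr)
    assume "\<not> (\<exists>n<s. Q n)"
    then have "(\<Sum>n<s. if Q n then Suc n else 0) = 0"
      by (intro sum.neutral) auto
    with sum show False by simp
  qed
  then obtain n where n: "n < s" "Q n"
    by blast
  have uniq: "k = n" if "Q k" for k
  proof (cases k n rule: linorder_cases)
    case less
    then have "1 < fuel_eval s f (k # xs)" using n(2) unfolding Q_def by blast
    then show ?thesis using that unfolding Q_def by simp
  next
    case greater
    then have "1 < fuel_eval s f (n # xs)" using that unfolding Q_def by blast
    then show ?thesis using n(2) unfolding Q_def by simp
  qed
  then have "Q = (\<lambda>k. k = n)"
    using n(2) by blast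
  then have "v = n"
    using sum n(1) by simp
  have zero: "recf_eval f (n # xs) = Some 0"
    using Mu.IH[of "n # xs" 0] n(2) unfolding Q_def by simp
  have pos: "\<exists>w. recf_eval f (m # xs) = Some (Suc w)" if "m < n" for m
  proof -
    have "1 < fuel_eval s f (m # xs)"
      using n(2) that unfolding Q_def by blast
    then have "fuel_eval s f (m # xs) = Suc (Suc (fuel_eval s f (m # xs) - 2))"
      by simp
    then show ?thesis using Mu.IH by blast
  qed
  have "(LEAST k. recf_eval f (k # xs) = Some 0) = n"
  proof (rule Least_equality[where P = "\<lambda>k. recf_eval f (k # xs) = Some 0"])
    fix k assume "recf_eval f (k # xs) = Some 0"
    then show "n \<le> k" using pos[of k] by (metis not_le option.inject nat.distinct(1))
  qed (rule zero)
  moreover have "recf_eval f (m # xs) \<noteq> None" if "m < n" for m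
    using pos[OF that] by auto
  then have "\<exists>k. recf_eval f (k # xs) = Some 0 \<and> (\<forall>m<k. recf_eval f (m # xs) \<noteq> None)"
    using zero by blast
  ultimately show ?case
    using \<open>v = n\<close> by simp
qed (auto split: list.splits if_splits)

text \<open>
  The conclusion asks for all sufficiently large amounts of fuel rather than for some amount, since the
  finitely many evaluations that a composition, a recursion or a search depends on need a common bound.
\<close>
lemma fuel_eval_complete: "recf_eval p xs = Some v \<Longrightarrow> \<exists>s0. \<forall>s\<ge>s0. fuel_eval s p xs = Suc v"
proof (induction p arbitrary: xs v)
  case (Comp f gs)
  have ne: "\<forall>g\<in>set gs. recf_eval g xs \<noteq> None"
    and ev: "recf_eval f (map (\<lambda>g. the (recf_eval g xs)) gs) = Some v"
    using Comp.prems by (auto split: if_splits)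
  have "\<forall>g\<in>set gs. \<exists>s0. \<forall>s\<ge>s0. fuel_eval s g xs = Suc (the (recf_eval g xs))"
    using Comp.IH(2) ne by force
  then obtain S where S: "\<And>g s. g \<in> set gs \<Longrightarrow> s \<ge> S g \<Longrightarrow> fuel_eval s g xs = Suc (the (recf_eval g xs))"
    by metis
  obtain s1 where s1: "\<And>s. s \<ge> s1 \<Longrightarrow> fuel_eval s f (map (\<lambda>g. the (recf_eval g xs)) gs) = Suc v"
    using Comp.IH(1)[OF ev] by blast
  have "fuel_eval s (Comp f gs) xs = Suc v" if "s \<ge> s1 + sum S (set gs)" for s
  proof -
    have "fuel_eval s g xs = Suc (the (recf_eval g xs))" if "g \<in> set gs" for g
      using S that \<open>s \<ge> s1 + sum S (set gs)\<close> member_le_sum[of g "set gs" S] by auto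
    moreover from this have eq: "map (\<lambda>g. fuel_eval s g xs - 1) gs = map (\<lambda>g. the (recf_eval g xs)) gs"
      by simp
    have "fuel_eval s f (map (\<lambda>g. fuel_eval s g xs - 1) gs) = Suc v"
      unfolding eq using s1 that by simp
    ultimately show ?thesis
      by simp
  qed
  then show ?case by blast
next
  case (PrimRec f g)
  then obtain n ys where xs: "xs = n # ys"
    by (cases xs) auto
  have "\<exists>s0. \<forall>s\<ge>s0. rec_nat (fuel_eval s f ys) (\<lambda>m r. if r = 0 then 0 else fuel_eval s g (m # (r - 1) # ys)) k = Suc w"
    if "rec_nat (recf_eval f ys) (\<lambda>m r. case r of None \<Rightarrow> None | Some v \<Rightarrow> recf_eval g (m # v # ys)) k = Some w"
    for k w
    using that
  proof (induction k arbitrary: w)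
    case 0
    then show ?case using PrimRec.IH(1) by simp
  next
    case (Suc k)
    then obtain u where u: "rec_nat (recf_eval f ys)
        (\<lambda>m r. case r of None \<Rightarrow> None | Some v \<Rightarrow> recf_eval g (m # v # ys)) k = Some u"
      "recf_eval g (k # u # ys) = Some w"
      by (auto split: option.splits)
    obtain s0 where s0: "\<And>s. s \<ge> s0 \<Longrightarrow> rec_nat (fuel_eval s f ys)
        (\<lambda>m r. if r = 0 then 0 else fuel_eval s g (m # (r - 1) # ys)) k = Suc u"
      using Suc.IH[OF u(1)] by blast
    obtain s1 where s1: "\<And>s. s \<ge> s1 \<Longrightarrow> fuel_eval s g (k # u # ys) = Suc w"
      using PrimRec.IH(2)[OF u(2)] by blast
    show ?case
      by (intro exI[of _ "max s0 s1"]) (simp add: s0 s1)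
  qed
  with PrimRec.prems show ?case unfolding xs by simp
next
  case (Mu f)
  let ?z = "\<lambda>n. recf_eval f (n # xs) = Some 0"
  have ex: "\<exists>n. ?z n \<and> (\<forall>m<n. recf_eval f (m # xs) \<noteq> None)" and v: "v = (LEAST n. ?z n)"
    using Mu.prems by (auto split: if_splits)
  then obtain n where n: "?z n" "\<forall>m<n. recf_eval f (m # xs) \<noteq> None"
    by blast
  have vz: "?z v" unfolding v by (rule LeastI[of ?z, OF n(1)])
  have "v \<le> n" unfolding v by (rule Least_le[of ?z, OF n(1)])
  have pos: "\<exists>w. recf_eval f (m # xs) = Some (Suc w)" if "m < v" for m
  proof -
    have "\<not> ?z m" using that not_less_Least[of m ?z] unfolding v by blast
    moreover have "recf_eval f (m # xs) \<noteq> None" using n(2) that \<open>v \<le> n\<close> by simp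
    ultimately show ?thesis using not0_implies_Suc by fastforce
  qed
  have "\<exists>s0. \<forall>s\<ge>s0. fuel_eval s f (m # xs) = Suc (the (recf_eval f (m # xs)))" if "m \<le> v" for m
    using Mu.IH[of "m # xs" "the (recf_eval f (m # xs))"] vz pos[of m] that
    by (cases "m = v") auto
  then obtain S where S: "\<And>m s. m \<le> v \<Longrightarrow> s \<ge> S m \<Longrightarrow> fuel_eval s f (m # xs) = Suc (the (recf_eval f (m # xs)))"
    by metis
  have "fuel_eval s (Mu f) xs = Suc v" if "s \<ge> Suc v + sum S {..v}" for s
  proof -
    have ev: "fuel_eval s f (m # xs) = Suc (the (recf_eval f (m # xs)))" if "m \<le> v" for m
      using S that \<open>s \<ge> Suc v + sum S {..v}\<close> member_le_sum[of m "{..v}" S] by auto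
    have at: "fuel_eval s f (v # xs) = 1"
      using ev[of v] vz by simp
    have below: "1 < fuel_eval s f (m # xs)" if "m < v" for m
      using ev[of m] pos[OF that] that by auto
    have "fuel_eval s f (n # xs) = 1 \<and> (\<forall>m<n. 1 < fuel_eval s f (m # xs)) \<longleftrightarrow> n = v" for n
      using at below by (cases n v rule: linorder_cases) fastforce+
    then have "fuel_eval s (Mu f) xs = (\<Sum>n<s. if n = v then Suc v else 0)"
      by (auto intro!: sum.cong)
    also have "\<dots> = Suc v" using that by simp
    finally show ?thesis .
  qed
  then show ?case by blast
qed (auto split: list.splits if_splits)

lemma computable_fuel_eval: "computable (Suc n) (\<lambda>ys. fuel_eval (hd ys) p (tl ys))"
proof (induction p arbitrary: n)
  case Zero
  show ?case by (simp add: computable_const)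
next
  case Succ
  show ?case
  proof (cases n)
    case 0
    then show ?thesis
      by (intro computable_cong[OF _ computable_const[of _ 0]]) (auto simp: length_Suc_conv)
  next
    case (Suc m)
    show ?thesis
      unfolding Suc
    proof (rule computable_cong)
      show "computable (Suc (Suc m)) (\<lambda>ys. Suc (Suc (hd (tl ys))))"
        by (intro computable_basic)
    qed (auto simp: length_Suc_conv)
  qed
next
  case (Proj i)
  show ?case
  proof (cases "i < n")
    case True
    then show ?thesis
      by (intro computable_cong[OF _ computable_Suc[OF computable_nth[of "Suc i"]]])
        (auto simp: length_Suc_conv)
  next
    case False
    then show ?thesis
      by (intro computable_cong[OF _ computable_const[of _ 0]]) auto
  qed
next
  case (Comp f gs)
  have dec: "decidable (Suc n) (\<lambda>ys. \<forall>g\<in>set hs. fuel_eval (hd ys) g (tl ys) \<noteq> 0)"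
    if "set hs \<subseteq> set gs" for hs
    using that
  proof (induction hs)
    case Nil
    have "decidable (Suc n) (\<lambda>ys. True)"
      using computable_const[of _ 0] unfolding decidable_def by simp
    then show ?case by simp
  next
    case (Cons h hs)
    have "decidable (Suc n) (\<lambda>ys. fuel_eval (hd ys) h (tl ys) \<noteq> 0 \<and>
        (\<forall>g\<in>set hs. fuel_eval (hd ys) g (tl ys) \<noteq> 0))"
      using Cons Comp.IH(2) by (intro decidable_conj decidable_not decidable_zero) auto
    then show ?case by simp
  qed
  have args: "computable_list (Suc n) (length hs) (\<lambda>ys. map (\<lambda>g. fuel_eval (hd ys) g (tl ys) - 1) hs)"
    if "set hs \<subseteq> set gs" for hs
    using that
  proof (induction hs)
    case Nil
    show ?case by (simp add: computable_list_Nil)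
  next
    case (Cons h hs)
    have "computable_list (Suc n) (Suc (length hs))
      (\<lambda>ys. (fuel_eval (hd ys) h (tl ys) - 1) # map (\<lambda>g. fuel_eval (hd ys) g (tl ys) - 1) hs)"
      using Cons Comp.IH(2) by (intro computable_list_Cons computable_pred) auto
    then show ?case by simp
  qed
  have "computable (Suc n)
     (\<lambda>ys. (\<lambda>zs. fuel_eval (hd zs) f (tl zs)) (hd ys # map (\<lambda>g. fuel_eval (hd ys) g (tl ys) - 1) gs))"
    by (rule computable_compose[OF Comp.IH(1)[of "length gs"]])
      (intro args computable_basic order_refl)
  then show ?case
    unfolding fuel_eval.simps
    by (intro computable_if dec computable_const) auto
next
  case (PrimRec f g)
  show ?case
  proof (cases n)
    case 0
    then show ?thesis
      by (intro computable_cong[OF _ computable_const[of _ 0]]) (auto simp: length_Suc_conv)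
  next
    case (Suc m)
    have base: "computable (Suc (Suc m)) (\<lambda>ys. (\<lambda>zs. fuel_eval (hd zs) f (tl zs)) (hd ys # tl (tl ys)))"
      by (rule computable_compose[OF PrimRec.IH(1)[of m]]) (intro computable_basic)
    have step: "computable (Suc (Suc (Suc (Suc m))))
      (\<lambda>zs. (\<lambda>us. fuel_eval (hd us) g (tl us))
         (hd (tl (tl zs)) # hd zs # (hd (tl zs) - 1) # tl (tl (tl (tl zs)))))"
      by (rule computable_compose[OF PrimRec.IH(2)[of "Suc (Suc m)"]]) (intro computable_pred computable_basic)
    have "computable (Suc (Suc m)) (\<lambda>ys. rec_nat (fuel_eval (hd ys) f (tl (tl ys)))
      (\<lambda>k r. if r = 0 then 0 else fuel_eval (hd ys) g (k # (r - 1) # tl (tl ys))) (hd (tl ys)))"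
      using base step
      by (intro computable_rec computable_if decidable_zero computable_basic) auto
    then show ?thesis
      unfolding Suc by (rule computable_cong[rotated]) (auto simp: length_Suc_conv cong: if_cong)
  qed
next
  case (Mu f)
  have 1: "computable (Suc (Suc n)) (\<lambda>zs. fuel_eval (hd (tl zs)) f (hd zs # tl (tl zs)))"
  proof -
    have "computable (Suc (Suc n))
      (\<lambda>zs. (\<lambda>us. fuel_eval (hd us) f (tl us)) (hd (tl zs) # hd zs # tl (tl zs)))"
      by (rule computable_compose[OF Mu.IH[of "Suc n"]]) (intro computable_basic)
    then show ?thesis by simp
  qed
  have 2: "computable (Suc (Suc (Suc n))) (\<lambda>zs. fuel_eval (hd (tl (tl zs))) f (hd zs # tl (tl (tl zs))))"
  proof -
    have "computable (Suc (Suc (Suc n)))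
      (\<lambda>zs. (\<lambda>us. fuel_eval (hd us) f (tl us)) (hd (tl (tl zs)) # hd zs # tl (tl (tl zs))))"
      by (rule computable_compose[OF Mu.IH[of "Suc n"]]) (intro computable_basic)
    then show ?thesis by simp
  qed
  show ?case
    unfolding fuel_eval.simps
    by (intro computable_sum computable_if decidable_conj decidable_all_less decidable_eq decidable_less
        1 2 computable_basic)
qed

theorem comp_enum_iff_semidecidable: "comp_enum W \<longleftrightarrow> semidecidable (Suc 0) (\<lambda>xs. hd xs \<in> W)"
proof
  assume "comp_enum W"
  then obtain p where p: "W = {x. recf_eval p [x] \<noteq> None}"
    unfolding comp_enum_def by blast
  have "x \<in> W \<longleftrightarrow> (\<exists>s. fuel_eval s p [x] \<noteq> 0)" for x
  proof
    assume "x \<in> W"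
    then obtain v where "recf_eval p [x] = Some v" unfolding p by blast
    then obtain s where "fuel_eval s p [x] = Suc v" using fuel_eval_complete by blast
    then show "\<exists>s. fuel_eval s p [x] \<noteq> 0" by (intro exI[of _ s]) simp
  next
    assume "\<exists>s. fuel_eval s p [x] \<noteq> 0"
    then obtain s v where "fuel_eval s p [x] = Suc v" using not0_implies_Suc by blast
    from fuel_eval_sound[OF this] show "x \<in> W" unfolding p by simp
  qed
  then show "semidecidable (Suc 0) (\<lambda>xs. hd xs \<in> W)"
    by (intro semidecidableI[where P = "\<lambda>s xs. fuel_eval s p xs \<noteq> 0"]
        decidable_not decidable_zero computable_fuel_eval) (auto simp: length_Suc_conv)
next
  assume "semidecidable (Suc 0) (\<lambda>xs. hd xs \<in> W)"
  then obtain P where P: "decidable (Suc (Suc 0)) P"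
    and "\<forall>xs. length xs = Suc 0 \<longrightarrow> (hd xs \<in> W \<longleftrightarrow> (\<exists>s. P (s # xs)))"
    unfolding semidecidable_def by blast
  from this(2) have W: "x \<in> W \<longleftrightarrow> (\<exists>s. P [s, x])" for x
    by (metis length_Cons list.sel(1) list.size(3))
  obtain p where p: "\<And>xs. length xs = Suc (Suc 0) \<Longrightarrow> recf_eval p xs = Some (if P xs then 0 else 1)"
    using P unfolding decidable_def computable_def by blast
  have "x \<in> W \<longleftrightarrow> recf_eval (Mu p) [x] \<noteq> None" for x
    by (auto simp: p W)
  then show "comp_enum W"
    unfolding comp_enum_def by blast
qed

lemma semidecidable_mem:
  assumes "comp_enum W" "computable n f"
  shows "semidecidable n (\<lambda>xs. f xs \<in> W)"
proof -
  have "semidecidable n (\<lambda>xs. hd [f xs] \<in> W)"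
    by (rule semidecidable_compose[OF assms(1)[unfolded comp_enum_iff_semidecidable]])
      (intro computable_basic assms)
  then show ?thesis by simp
qed

lemma comp_enumI:
  assumes "semidecidable (Suc 0) (\<lambda>xs. R (hd xs))"
  shows "comp_enum {x. R x}"
  using assms by (simp add: comp_enum_iff_semidecidable)


section \<open>Enumeration reducibility\<close>

lemma mem_set_decode_le: "x \<in> set_decode u \<Longrightarrow> x \<le> u"
proof -
  assume "x \<in> set_decode u"
  then have "u div 2 ^ x \<noteq> 0"
    by (auto simp: set_decode_def intro: ccontr)
  then have "2 ^ x \<le> u"
    by (metis div_less not_le)
  then show ?thesis
    using less_exp[of x] by linarith
qed

lemma decidable_mem_set_decode:
  assumes "computable n f" "computable n g"
  shows "decidable n (\<lambda>xs. f xs \<in> set_decode (g xs))"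
proof -
  have bit: "x \<in> set_decode u \<longleftrightarrow> (\<exists>q<Suc u. \<exists>r<2 ^ x. u = Suc (q + q) * 2 ^ x + r)" for x u
  proof
    assume "x \<in> set_decode u"
    then obtain q where "u div 2 ^ x = 2 * q + 1"
      unfolding set_decode_def by (auto elim: oddE)
    then have "u = Suc (q + q) * 2 ^ x + u mod 2 ^ x" and "q \<le> u div 2 ^ x"
      using div_mult_mod_eq[of u "2 ^ x"] by (simp_all add: mult_2)
    moreover have "u div 2 ^ x \<le> u"
      by simp
    ultimately show "\<exists>q<Suc u. \<exists>r<2 ^ x. u = Suc (q + q) * 2 ^ x + r"
      by (metis le_imp_less_Suc le_trans mod_less_divisor zero_less_numeral zero_less_power)
  next
    assume "\<exists>q<Suc u. \<exists>r<2 ^ x. u = Suc (q + q) * 2 ^ x + r"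
    then obtain q r where "r < 2 ^ x" "u = r + Suc (q + q) * 2 ^ x"
      by (auto simp: add.commute)
    then have "u div 2 ^ x = Suc (q + q)"
      by (simp del: mult_Suc)
    then show "x \<in> set_decode u"
      by (simp add: set_decode_def)
  qed
  have "decidable (Suc (Suc 0)) (\<lambda>ys. hd ys \<in> set_decode (hd (tl ys)))"
    unfolding bit
    by (intro decidable_ex_less decidable_eq computable_add computable_mult computable_power2
        computable_basic)
  then have "decidable n (\<lambda>xs. hd [f xs, g xs] \<in> set_decode (hd (tl [f xs, g xs])))"
    by (rule decidable_compose) (intro computable_basic assms)
  then show ?thesis by simp
qed

text \<open>
  The operator enumerates the members of \<open>C\<close> unconditionally, and passes on a member of \<open>D\<close> once the oracle
  supplies it: the set with canonical index \<open>2 ^ x\<close> is \<open>{x}\<close>.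
\<close>
lemma comp_enum_Un_Int_enum_le:
  assumes "comp_enum C" "comp_enum D"
  shows "C \<union> (A \<inter> D) \<le>\<^sub>e A"
proof -
  let ?W = "{z. \<exists>x u. z = prod_encode (x, u) \<and> (x \<in> C \<or> x \<in> D \<and> u = 2 ^ x)}"
  have "comp_enum ?W"
    by (intro comp_enumI semidecidable_ex semidecidable_conj semidecidable_disj semidecidable_mem
        semidecidable_decidable[OF decidable_eq] computable_prod_encode computable_power2
        computable_basic assms)
  moreover have "C \<union> (A \<inter> D) = enum_op ?W A"
  proof -
    have single: "set_decode (2 ^ x) = {x}" for x
      using set_encode_inverse[of "{x}"] set_encode_insert[of "{}" x] by simp
    show ?thesis
      unfolding enum_op_def by (auto simp: single intro: exI[of _ 0])
  qed
  ultimately show ?thesis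
    unfolding enum_le_def enumeration_operator_def by blast
qed

lemma comp_enum_UNIV: "comp_enum UNIV"
  unfolding comp_enum_def by (rule exI[of _ Zero]) simp

lemma comp_enum_empty: "comp_enum {}"
  unfolding comp_enum_def by (rule exI[of _ "Proj 1"]) simp

lemma enum_le_refl: "A \<le>\<^sub>e A"
  using comp_enum_Un_Int_enum_le[OF comp_enum_empty comp_enum_UNIV, of A] by simp

text \<open>
  To compose two operators, the finitely many oracle sets that the inner one needs are not coded
  individually. It suffices to guess one finite set with index \<open>w\<close> that includes them all, which leaves only
  quantifiers bounded by \<open>u\<close> and \<open>v\<close> since members of a set are at most its canonical index.
\<close>
lemma enum_le_trans:
  assumes "A \<le>\<^sub>e B" "B \<le>\<^sub>e C"
  shows "A \<le>\<^sub>e C"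
proof -
  obtain V W where V: "comp_enum V" "A = enum_op V B" and W: "comp_enum W" "B = enum_op W C"
    using assms unfolding enum_le_def enumeration_operator_def by blast
  let ?sub = "\<lambda>v w. \<forall>i<Suc v. i \<in> set_decode v \<longrightarrow> i \<in> set_decode w"
  let ?good = "\<lambda>u w. \<forall>y<Suc u. y \<notin> set_decode u \<or> (\<exists>v. prod_encode (y, v) \<in> W \<and> ?sub v w)"
  let ?U = "{z. \<exists>x w u. z = prod_encode (x, w) \<and> prod_encode (x, u) \<in> V \<and> ?good u w}"
  have "comp_enum ?U"
    by (intro comp_enumI semidecidable_ex semidecidable_conj semidecidable_all_less semidecidable_disj
        semidecidable_mem V(1) W(1) semidecidable_decidable[OF decidable_eq]
        semidecidable_decidable[OF decidable_not] semidecidable_decidable[OF decidable_all_less]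
        decidable_imp decidable_mem_set_decode computable_prod_encode computable_basic)
  moreover have "A = enum_op ?U C"
  proof -
    have sub: "?sub v w \<longleftrightarrow> set_decode v \<subseteq> set_decode w" for v w
      using mem_set_decode_le by (auto simp: less_Suc_eq_le)
    have good: "?good u w \<longleftrightarrow> (\<forall>y\<in>set_decode u. \<exists>v. prod_encode (y, v) \<in> W \<and> set_decode v \<subseteq> set_decode w)" for u w
      using mem_set_decode_le unfolding sub by (metis less_Suc_eq_le)
    have "x \<in> enum_op ?U C \<longleftrightarrow>
        (\<exists>u. prod_encode (x, u) \<in> V \<and> (\<exists>w. ?good u w \<and> set_decode w \<subseteq> C))" for x
      unfolding enum_op_def mem_Collect_eq prod_encode_eq prod.inject by blast
    moreover have "(\<exists>w. ?good u w \<and> set_decode w \<subseteq> C) \<longleftrightarrow> set_decode u \<subseteq> B" for u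
      unfolding good
    proof
      assume "set_decode u \<subseteq> B"
      then have "\<forall>y\<in>set_decode u. \<exists>v. prod_encode (y, v) \<in> W \<and> set_decode v \<subseteq> C"
        unfolding W(2) enum_op_def by blast
      then obtain v where v: "\<And>y. y \<in> set_decode u \<Longrightarrow> prod_encode (y, v y) \<in> W \<and> set_decode (v y) \<subseteq> C"
        by metis
      have "set_decode (set_encode (\<Union>y\<in>set_decode u. set_decode (v y))) = (\<Union>y\<in>set_decode u. set_decode (v y))"
        by (intro set_encode_inverse) auto
      with v show "\<exists>w. (\<forall>y\<in>set_decode u. \<exists>v. prod_encode (y, v) \<in> W \<and> set_decode v \<subseteq> set_decode w) \<and> set_decode w \<subseteq> C"
        by (intro exI[of _ "set_encode (\<Union>y\<in>set_decode u. set_decode (v y))"]) auto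
    qed (unfold W(2) enum_op_def, blast)
    ultimately show ?thesis
      unfolding V(2) by (simp add: enum_op_def[of V] set_eq_iff)
  qed
  ultimately show ?thesis
    unfolding enum_le_def enumeration_operator_def by blast
qed

lemma enum_op_mono: "A \<subseteq> B \<Longrightarrow> enum_op W A \<subseteq> enum_op W B"
  unfolding enum_op_def by blast

lemma enum_op_finitary:
  assumes "x \<in> enum_op W A"
  obtains E where "finite E" "E \<subseteq> A" "x \<in> enum_op W E"
  using assms finite_set_decode unfolding enum_op_def by blast

instance recf :: countable
  by countable_datatype

lemma countable_comp_enum: "countable (Collect comp_enum)"
proof -
  have "Collect comp_enum = range (\<lambda>p. {x. recf_eval p [x] \<noteq> None})"
    unfolding comp_enum_def by auto
  then show ?thesis by simp
qed

lemma pfun_enum_le_refl: "pfun_enum_le \<phi> \<phi>"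
  unfolding pfun_enum_le_def by (rule enum_le_refl)

lemma pfun_enum_le_trans: "pfun_enum_le \<phi> \<psi> \<Longrightarrow> pfun_enum_le \<psi> \<chi> \<Longrightarrow> pfun_enum_le \<phi> \<chi>"
  unfolding pfun_enum_le_def by (rule enum_le_trans)


section \<open>Generic sets\<close>

text \<open>
  Conditions are pairs of disjoint finite sets, the first to be contained in the set under construction and
  the second to be disjoint from it. A generic set is one that decides sufficiently many sets \<open>D\<close> of
  conditions: it obeys a condition in \<open>D\<close> or one that cannot be strengthened to a condition in \<open>D\<close>.
\<close>
definition settles :: "'a set \<Rightarrow> 'a set \<Rightarrow> ('a set \<times> 'a set) set \<Rightarrow> bool" where
  "settles p N D \<longleftrightarrow> (p, N) \<in> D \<or>
     (\<forall>q M. finite q \<longrightarrow> finite M \<longrightarrow> q \<inter> M = {} \<longrightarrow> p \<subseteq> q \<longrightarrow> N \<subseteq> M \<longrightarrow> (q, M) \<notin> D)"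

definition decides :: "'a set \<Rightarrow> ('a set \<times> 'a set) set \<Rightarrow> bool" where
  "decides G D \<longleftrightarrow> (\<exists>p N. finite p \<and> finite N \<and> p \<subseteq> G \<and> N \<inter> G = {} \<and> settles p N D)"

lemma settlesD:
  assumes "settles p N D" "(p, N) \<notin> D" "finite q" "finite M" "q \<inter> M = {}" "p \<subseteq> q" "N \<subseteq> M"
  shows "(q, M) \<notin> D"
  using assms unfolding settles_def by blast

lemma generic_exists:
  fixes F :: "('a set \<times> 'a set) set set"
  assumes "countable F"
  shows "\<exists>G. \<forall>D\<in>F. decides G D"
proof (cases "F = {}")
  case False
  define D where "D = from_nat_into F"
  have D: "range D = F"
    unfolding D_def using False assms by (rule range_from_nat_into)
  define cond :: "'a set \<times> 'a set \<Rightarrow> bool"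
    where "cond c \<longleftrightarrow> finite (fst c) \<and> finite (snd c) \<and> fst c \<inter> snd c = {}" for c
  define ext :: "'a set \<times> 'a set \<Rightarrow> 'a set \<times> 'a set \<Rightarrow> bool"
    where "ext c d \<longleftrightarrow> fst c \<subseteq> fst d \<and> snd c \<subseteq> snd d" for c d
  have "\<exists>c. \<forall>n. cond (c n) \<and> (ext (c n) (c (Suc n)) \<and>
      (c (Suc n) \<in> D n \<or> (\<forall>d. cond d \<longrightarrow> ext (c (Suc n)) d \<longrightarrow> d \<notin> D n)))"
  proof (rule dependent_nat_choice)
    show "\<exists>c. cond c"
      by (rule exI[of _ "({}, {})"]) (simp add: cond_def)
    show "\<exists>d. cond d \<and> ext c d \<and> (d \<in> D n \<or> (\<forall>e. cond e \<longrightarrow> ext d e \<longrightarrow> e \<notin> D n))"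
      if "cond c" for c n
    proof (cases "\<exists>d. cond d \<and> ext c d \<and> d \<in> D n")
      case False
      with that show ?thesis by (intro exI[of _ c]) (auto simp: ext_def)
    qed blast
  qed
  then obtain c where c: "\<And>n. cond (c n)" "\<And>n. ext (c n) (c (Suc n))"
    "\<And>n. c (Suc n) \<in> D n \<or> (\<forall>d. cond d \<longrightarrow> ext (c (Suc n)) d \<longrightarrow> d \<notin> D n)"
    by blast
  have mono: "fst (c m) \<subseteq> fst (c n)" "snd (c m) \<subseteq> snd (c n)" if "m \<le> n" for m n
    by (rule lift_Suc_mono_le[OF _ that], use c(2) in \<open>simp add: ext_def\<close>)+
  define G where "G = (\<Union>n. fst (c n))"
  have "snd (c n) \<inter> G = {}" for n
  proof -
    have "snd (c n) \<inter> fst (c m) = {}" for m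
      using mono(1)[of m "max m n"] mono(2)[of n "max m n"] c(1)[of "max m n"] unfolding cond_def
      by auto
    then show ?thesis unfolding G_def by blast
  qed
  moreover have "fst (c n) \<subseteq> G" for n
    unfolding G_def by blast
  ultimately have "decides G (D n)" for n
    unfolding decides_def settles_def
    using c(1)[of "Suc n"] c(3)[of n]
    by (intro exI[of _ "fst (c (Suc n))"] exI[of _ "snd (c (Suc n))"]) (auto simp: cond_def ext_def)
  then show ?thesis
    using D by blast
qed simp

definition forcing_value :: "('a set \<Rightarrow> 'b set) \<Rightarrow> 'a set \<Rightarrow> 'b \<Rightarrow> ('a set \<times> 'a set) set" where
  "forcing_value \<Psi> T x = {(q, M). x \<in> \<Psi> (q \<inter> T)}"

text \<open>
  Excluding the finite set \<open>M\<close> keeps \<open>x\<close> out of the second result for good: by monotonicity, whatever set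
  disjoint from \<open>M\<close> is built, its part in \<open>T\<close> yields no more than \<open>T - M\<close> does.
\<close>
definition forcing_difference ::
    "('a set \<Rightarrow> 'b set) \<Rightarrow> ('a set \<Rightarrow> 'b set) \<Rightarrow> 'a set \<Rightarrow> 'a set \<Rightarrow> ('a set \<times> 'a set) set" where
  "forcing_difference \<Phi> \<Psi> S T = {(q, M). \<exists>x. x \<in> \<Phi> (q \<inter> S) \<and> x \<notin> \<Psi> (T - M)}"

definition forcing_separation :: "'a set \<Rightarrow> 'a set \<Rightarrow> ('a set \<times> 'a set) set" where
  "forcing_separation C V = {(q, M). \<exists>a\<in>C. a \<in> q - V \<or> a \<in> M \<inter> V}"

text \<open>
  If two parts of a generic set yield the same result under monotone finitary operators, then all that
  the first operator can use of its part beyond the common one is a finite piece of negative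
  information. Indeed, fix a condition that either forces a difference between the two results or has no
  extension doing so. In the second case a value \<open>x\<close> computed from positive information allowed
  by the condition but not necessarily correct outside \<open>T\<close> cannot fail to be in the second result: since
  the second operator does not look outside \<open>T\<close>, a condition on \<open>G\<close> excluding \<open>x\<close> from
  its result can be combined with that incorrect information, and the combination would have an
  extension forcing a difference.
\<close>
lemma generic_meet:
  fixes \<Phi> \<Psi> :: "'a set \<Rightarrow> 'b set"
  assumes mono: "\<And>A B. A \<subseteq> B \<Longrightarrow> \<Phi> A \<subseteq> \<Phi> B" "\<And>A B. A \<subseteq> B \<Longrightarrow> \<Psi> A \<subseteq> \<Psi> B"
    and finitary: "\<And>x A. x \<in> \<Phi> A \<Longrightarrow> \<exists>E. finite E \<and> E \<subseteq> A \<and> x \<in> \<Phi> E"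
      "\<And>x A. x \<in> \<Psi> A \<Longrightarrow> \<exists>E. finite E \<and> E \<subseteq> A \<and> x \<in> \<Psi> E"
    and difference: "decides G (forcing_difference \<Phi> \<Psi> S T)"
    and val: "\<And>x. decides G (forcing_value \<Psi> T x)"
    and eq: "\<Phi> (G \<inter> S) = \<Psi> (G \<inter> T)"
  shows "\<exists>N. finite N \<and> \<Phi> (G \<inter> S) = \<Phi> ((G \<inter> (S \<inter> T)) \<union> (S - T - N))"
proof -
  obtain p N where fin: "finite p" "finite N" and pN: "p \<subseteq> G" "N \<inter> G = {}"
    and settled: "settles p N (forcing_difference \<Phi> \<Psi> S T)"
    using difference unfolding decides_def by blast
  have "\<Phi> (p \<inter> S) \<subseteq> \<Phi> (G \<inter> S)" "\<Psi> (G \<inter> T) \<subseteq> \<Psi> (T - N)"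
    by (rule mono, use pN in blast)+
  then have "(p, N) \<notin> forcing_difference \<Phi> \<Psi> S T"
    using eq unfolding forcing_difference_def by auto
  then have none: "x \<in> \<Psi> (T - M)"
    if "finite q" "finite M" "q \<inter> M = {}" "p \<subseteq> q" "N \<subseteq> M" "x \<in> \<Phi> (q \<inter> S)" for q M x
    using settlesD[OF settled _ that(1-5)] that(6) unfolding forcing_difference_def by blast
  have "x \<in> \<Psi> (G \<inter> T)" if x: "x \<in> \<Phi> ((G \<inter> (S \<inter> T)) \<union> (S - T - N))" for x
  proof (rule ccontr)
    assume "x \<notin> \<Psi> (G \<inter> T)"
    obtain p' N' where fin': "finite p'" "finite N'" and pN': "p' \<subseteq> G" "N' \<inter> G = {}"
      and settled': "settles p' N' (forcing_value \<Psi> T x)"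
      using val[of x] unfolding decides_def by blast
    have "\<Psi> (p' \<inter> T) \<subseteq> \<Psi> (G \<inter> T)"
      using pN' by (intro mono) blast
    with \<open>x \<notin> \<Psi> (G \<inter> T)\<close> have "(p', N') \<notin> forcing_value \<Psi> T x"
      unfolding forcing_value_def by blast
    then have excl: "x \<notin> \<Psi> (q \<inter> T)" if "finite q" "q \<inter> N' = {}" "p' \<subseteq> q" for q
      using settlesD[OF settled' _ that(1) fin'(2) that(2,3) order_refl] unfolding forcing_value_def by blast
    obtain E where E: "finite E" "E \<subseteq> (G \<inter> (S \<inter> T)) \<union> (S - T - N)" "x \<in> \<Phi> E"
      using finitary(1)[OF x] by blast
    \<comment> \<open>The stronger condition need not be obeyed by \<open>G\<close>: outside \<open>T\<close>, it asserts \<open>E\<close> against \<open>G\<close>.\<close>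
    have "x \<in> \<Psi> (T - (N \<union> N' \<inter> T))"
    proof (rule none)
      show "finite (p \<union> E)" "finite (N \<union> N' \<inter> T)"
        using E(1) fin fin' by simp_all
      show "(p \<union> E) \<inter> (N \<union> N' \<inter> T) = {}"
        using E(2) pN pN' by blast
      show "p \<subseteq> p \<union> E" "N \<subseteq> N \<union> N' \<inter> T"
        by blast+
      have "\<Phi> E \<subseteq> \<Phi> ((p \<union> E) \<inter> S)"
        using E(2) by (intro mono) blast
      with E(3) show "x \<in> \<Phi> ((p \<union> E) \<inter> S)"
        by blast
    qed
    from finitary(2)[OF this] obtain E'
      where E': "finite E'" "E' \<subseteq> T - (N \<union> N' \<inter> T)" "x \<in> \<Psi> E'"
      by blast
    have "\<Psi> E' \<subseteq> \<Psi> ((p' \<union> E') \<inter> T)"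
      using E'(2) by (intro mono) blast
    moreover have "x \<notin> \<Psi> ((p' \<union> E') \<inter> T)"
    proof (rule excl)
      show "(p' \<union> E') \<inter> N' = {}"
        using E'(2) pN' by blast
    qed (use E'(1) fin' in simp_all)
    ultimately show False
      using E'(3) by blast
  qed
  moreover have "\<Phi> (G \<inter> S) \<subseteq> \<Phi> ((G \<inter> (S \<inter> T)) \<union> (S - T - N))"
    using pN by (intro mono) blast
  ultimately show ?thesis
    using fin eq by blast
qed

text \<open>
  A condition leaves some point of the infinite set \<open>C\<close> open, and putting that point in or leaving it out,
  against \<open>V\<close>, extends it to one in the set being decided; hence such a condition is met.
\<close>
lemma generic_separation:
  assumes "decides G (forcing_separation C V)" "infinite C"
  shows "G \<inter> C \<noteq> V"
proof -
  obtain p N where fin: "finite p" "finite N" and pN: "p \<subseteq> G" "N \<inter> G = {}"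
    and settled: "settles p N (forcing_separation C V)"
    using assms(1) unfolding decides_def by blast
  have "infinite (C - (p \<union> N))"
    using assms(2) fin by (simp add: Diff_infinite_finite)
  then obtain a where a: "a \<in> C" "a \<notin> p" "a \<notin> N"
    by (metis Diff_iff Un_iff equals0I finite.emptyI)
  have disj: "p \<inter> N = {}"
    using pN by blast
  have "(p, N) \<in> forcing_separation C V"
  proof (rule ccontr)
    assume "(p, N) \<notin> forcing_separation C V"
    note none = settlesD[OF settled this]
    show False
    proof (cases "a \<in> V")
      case True
      then show False using none[of p "insert a N"] fin a disj unfolding forcing_separation_def by blast
    next
      case False
      then show False using none[of "insert a p" N] fin a disj unfolding forcing_separation_def by blast
    qed
  qed
  then show ?thesis
    using pN unfolding forcing_separation_def by blast
qed


section \<open>A meet-preserving tree of enumeration degrees\<close>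

text \<open>
  A set \<open>S\<close> of points corresponds to a partial function with \<open>0\<close> as its only value; \<open>point_code ` S\<close> is
  its coded graph.
\<close>
definition point_code :: "nat list \<times> nat \<Rightarrow> nat" where
  "point_code a = prod_encode (prod_encode (list_encode (fst a), snd a), 0)"

definition columns :: "nat list set \<Rightarrow> (nat list \<times> nat) set" where
  "columns B = {a. fst a \<in> B}"

lemma inj_point_code: "inj point_code"
  by (rule injI) (auto simp: point_code_def list_encode_eq prod_eq_iff)

lemma comp_enum_Un: "comp_enum C \<Longrightarrow> comp_enum D \<Longrightarrow> comp_enum (C \<union> D)"
  by (simp add: comp_enum_iff_semidecidable semidecidable_disj)

lemma comp_enum_Diff_finite:
  assumes "comp_enum C" "finite N"
  shows "comp_enum (C - N)"
  using assms(2)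
proof (induction N)
  case (insert n N)
  have "comp_enum {x. x \<in> C - N \<and> x \<noteq> n}"
    by (intro comp_enumI semidecidable_conj semidecidable_mem insert.IH
        semidecidable_decidable[OF decidable_not[OF decidable_eq]] computable_basic)
  moreover have "{x. x \<in> C - N \<and> x \<noteq> n} = C - insert n N"
    by blast
  ultimately show ?case by simp
qed (use assms in simp)

lemma comp_enum_columns:
  assumes "finite B" "finite N"
  shows "comp_enum (point_code ` (columns B - N))"
proof -
  have "comp_enum (point_code ` columns B)"
    using assms(1)
  proof (induction B)
    case (insert c B)
    have "comp_enum {z. \<exists>x. z = prod_encode (prod_encode (list_encode c, x), 0)}"
      by (intro comp_enumI semidecidable_ex semidecidable_decidable[OF decidable_eq]
          computable_prod_encode computable_basic)
    moreover have "point_code ` columns (insert c B) =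
        {z. \<exists>x. z = prod_encode (prod_encode (list_encode c, x), 0)} \<union> point_code ` columns B"
    proof -
      have "columns (insert c B) = ({c} \<times> UNIV) \<union> columns B"
        unfolding columns_def by auto
      moreover have "point_code ` ({c} \<times> UNIV) = {z. \<exists>x. z = prod_encode (prod_encode (list_encode c, x), 0)}"
        by (auto simp: point_code_def image_iff)
      ultimately show ?thesis by (simp only: image_Un)
    qed
    ultimately show ?case
      using insert.IH by (simp add: comp_enum_Un)
  qed (simp add: columns_def comp_enum_empty)
  then show ?thesis
    unfolding image_set_diff[OF inj_point_code] using assms(2) by (intro comp_enum_Diff_finite) auto
qed

text \<open>
  The third clause separates the part of \<open>G\<close> in any finite family of columns from the c.e. sets, which
  are written here as the results of enumeration operators with empty oracle.
\<close>
definition columns_generic :: "(nat list \<times> nat) set \<Rightarrow> bool" where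
  "columns_generic G \<longleftrightarrow>
     (\<forall>V W B B'. comp_enum V \<longrightarrow> comp_enum W \<longrightarrow> finite B \<longrightarrow> finite B' \<longrightarrow>
        decides G (forcing_difference (\<lambda>A. enum_op V (point_code ` A)) (\<lambda>A. enum_op W (point_code ` A))
          (columns B) (columns B'))) \<and>
     (\<forall>W B x. comp_enum W \<longrightarrow> finite B \<longrightarrow>
        decides G (forcing_value (\<lambda>A. enum_op W (point_code ` A)) (columns B) x)) \<and>
     (\<forall>W B. comp_enum W \<longrightarrow> finite B \<longrightarrow>
        decides G (forcing_separation (columns B) (point_code -` enum_op W {})))"

lemma columns_generic_exists: "\<exists>G. columns_generic G"
proof -
  let ?E = "Collect comp_enum" and ?B = "Collect finite :: nat list set set"
  let ?F1 = "(\<lambda>(V, W, B, B'). forcing_difference (\<lambda>A. enum_op V (point_code ` A))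
      (\<lambda>A. enum_op W (point_code ` A)) (columns B) (columns B')) ` (?E \<times> ?E \<times> ?B \<times> ?B)"
  let ?F2 = "(\<lambda>(W, B, x). forcing_value (\<lambda>A. enum_op W (point_code ` A)) (columns B) x) ` (?E \<times> ?B \<times> UNIV)"
  let ?F3 = "(\<lambda>(W, B). forcing_separation (columns B) (point_code -` enum_op W {})) ` (?E \<times> ?B)"
  have "countable (?F1 \<union> ?F2 \<union> ?F3)"
    by (intro countable_Un countable_image countable_SIGMA countable_comp_enum countable_Collect_finite
        countableI_type)
  from generic_exists[OF this] obtain G where "\<forall>D\<in>?F1 \<union> ?F2 \<union> ?F3. decides G D"
    by blast
  then have "columns_generic G"
    unfolding columns_generic_def by fastforce
  then show ?thesis by blast
qed

lemma columns_Int: "columns B \<inter> columns B' = columns (B \<inter> B')"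
  and columns_Diff: "columns B - columns B' = columns (B - B')"
  unfolding columns_def by auto

lemma columns_enum_le:
  assumes "B \<subseteq> B'" "finite B"
  shows "point_code ` (G \<inter> columns B) \<le>\<^sub>e point_code ` (G \<inter> columns B')"
proof -
  have "comp_enum (point_code ` columns B)"
    using comp_enum_columns[OF assms(2), of "{}"] by simp
  then have "{} \<union> (point_code ` (G \<inter> columns B') \<inter> point_code ` columns B) \<le>\<^sub>e point_code ` (G \<inter> columns B')"
    by (rule comp_enum_Un_Int_enum_le[OF comp_enum_empty])
  moreover have "{} \<union> (point_code ` (G \<inter> columns B') \<inter> point_code ` columns B) = point_code ` (G \<inter> columns B)"
    using assms(1) unfolding image_Int[OF inj_point_code, symmetric] columns_def by auto
  ultimately show ?thesis by simp
qed

text \<open>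
  The additional positive information left over by \<open>generic_meet\<close> consists of finitely many columns with
  finitely many points removed. It is c.e. and hence can be absorbed into the reduction.
\<close>
lemma columns_meet:
  assumes G: "columns_generic G" and B: "finite B" "finite B'"
    and X: "X \<le>\<^sub>e point_code ` (G \<inter> columns B)" "X \<le>\<^sub>e point_code ` (G \<inter> columns B')"
  shows "X \<le>\<^sub>e point_code ` (G \<inter> columns (B \<inter> B'))"
proof -
  obtain V W where V: "comp_enum V" "X = enum_op V (point_code ` (G \<inter> columns B))"
    and W: "comp_enum W" "X = enum_op W (point_code ` (G \<inter> columns B'))"
    using X unfolding enum_le_def enumeration_operator_def by metis
  have mono: "enum_op U (point_code ` A) \<subseteq> enum_op U (point_code ` A')" if "A \<subseteq> A'" for U A A'
    using that by (intro enum_op_mono) blast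
  have finitary: "\<exists>E. finite E \<and> E \<subseteq> A \<and> x \<in> enum_op U (point_code ` E)"
    if "x \<in> enum_op U (point_code ` A)" for U A x
    using enum_op_finitary[OF that] by (metis finite_subset_image)
  have "\<exists>N. finite N \<and> X = enum_op V (point_code ` ((G \<inter> (columns B \<inter> columns B')) \<union> (columns B - columns B' - N)))"
    unfolding V(2)
    by (rule generic_meet[where \<Psi> = "\<lambda>A. enum_op W (point_code ` A)"])
      (use G V W B mono finitary in \<open>auto simp: columns_generic_def\<close>)
  then obtain N where N: "finite N"
    "X = enum_op V (point_code ` ((G \<inter> columns (B \<inter> B')) \<union> (columns (B - B') - N)))"
    unfolding columns_Int columns_Diff by blast
  then have "X \<le>\<^sub>e point_code ` (columns (B - B') - N) \<union> (point_code ` (G \<inter> columns (B \<inter> B')) \<inter> UNIV)"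
    using V(1) unfolding enum_le_def enumeration_operator_def image_Un by (auto simp: Un_commute)
  also have "\<dots> \<le>\<^sub>e point_code ` (G \<inter> columns (B \<inter> B'))"
    using comp_enum_columns N(1) B by (intro comp_enum_Un_Int_enum_le comp_enum_UNIV) auto
  finally (enum_le_trans) show ?thesis .
qed

text \<open>
  A column of \<open>G\<close> that is enumerated by finitely many other columns is enumerated by their common part with
  itself, which is empty; but a generic column is not c.e.
\<close>
lemma columns_subset_of_enum_le:
  assumes G: "columns_generic G" and B: "finite B" "finite B'"
    and le: "point_code ` (G \<inter> columns B) \<le>\<^sub>e point_code ` (G \<inter> columns B')"
  shows "B \<subseteq> B'"
proof
  fix c assume "c \<in> B"
  show "c \<in> B'"
  proof (rule ccontr)
    assume "c \<notin> B'"
    let ?X = "point_code ` (G \<inter> columns {c})"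
    have "?X \<le>\<^sub>e point_code ` (G \<inter> columns B')"
      using columns_enum_le[of "{c}" B G] \<open>c \<in> B\<close> le enum_le_trans by auto
    then have "?X \<le>\<^sub>e point_code ` (G \<inter> columns ({c} \<inter> B'))"
      using columns_meet[OF G _ B(2) enum_le_refl] by simp
    then have "?X \<le>\<^sub>e {}"
      using \<open>c \<notin> B'\<close> by (simp add: columns_def)
    then obtain W where W: "comp_enum W" "?X = enum_op W {}"
      unfolding enum_le_def enumeration_operator_def by blast
    have "G \<inter> columns {c} = point_code -` enum_op W {}"
      unfolding W(2)[symmetric] by (simp add: inj_vimage_image_eq[OF inj_point_code])
    moreover have "G \<inter> columns {c} \<noteq> point_code -` enum_op W {}"
    proof (rule generic_separation)
      show "decides G (forcing_separation (columns {c}) (point_code -` enum_op W {}))"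
        using G W(1) unfolding columns_generic_def by blast
      have "columns {c} = {c} \<times> UNIV"
        unfolding columns_def by auto
      then show "infinite (columns {c})"
        by (simp add: finite_cartesian_product_iff)
    qed
    ultimately show False by contradiction
  qed
qed

text \<open>
  The columns of \<open>G\<close> are indexed by the nodes of the tree of finite sequences, and a node gets the part
  of \<open>G\<close> in the columns of its initial segments.
\<close>
theorem enum_degree_tree:
  "\<exists>d :: nat list \<Rightarrow> nat \<rightharpoonup> nat.
     (\<forall>\<sigma> \<tau>. pfun_enum_le (d \<sigma>) (d \<tau>) \<longleftrightarrow> prefix \<sigma> \<tau>) \<and>
     (\<forall>\<phi> \<sigma> \<tau>. pfun_enum_le \<phi> (d \<sigma>) \<longrightarrow> pfun_enum_le \<phi> (d \<tau>) \<longrightarrow>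
       pfun_enum_le \<phi> (d (longest_common_prefix \<sigma> \<tau>)))"
proof -
  obtain G where G: "columns_generic G"
    using columns_generic_exists by blast
  define below :: "nat list \<Rightarrow> nat list set" where "below \<sigma> = {\<rho>. prefix \<rho> \<sigma>}" for \<sigma>
  define d :: "nat list \<Rightarrow> nat \<rightharpoonup> nat" where
    "d \<sigma> = (\<lambda>n. if \<exists>c x. (c, x) \<in> G \<inter> columns (below \<sigma>) \<and> n = prod_encode (list_encode c, x)
       then Some 0 else None)" for \<sigma>
  have graph: "prod_encode ` Map.graph (d \<sigma>) = point_code ` (G \<inter> columns (below \<sigma>))" for \<sigma>
  proof -
    have "Map.graph (d \<sigma>) = (\<lambda>a. (prod_encode (list_encode (fst a), snd a), 0)) ` (G \<inter> columns (below \<sigma>))"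
      unfolding Map.graph_def d_def by (auto simp: image_iff Bex_def split: if_split_asm)
    then show ?thesis
      by (simp add: image_image point_code_def)
  qed
  have fin: "finite (below \<sigma>)" for \<sigma>
    unfolding below_def set_prefixes_eq[symmetric] by simp
  have meet: "below (longest_common_prefix \<sigma> \<tau>) = below \<sigma> \<inter> below \<tau>" for \<sigma> \<tau>
    unfolding below_def
    using prefix_order.trans[OF _ longest_common_prefix_prefix1[of \<sigma> \<tau>]]
      prefix_order.trans[OF _ longest_common_prefix_prefix2[of \<sigma> \<tau>]]
      longest_common_prefix_max_prefix[of _ \<sigma> \<tau>] by auto
  have sub: "below \<sigma> \<subseteq> below \<tau> \<longleftrightarrow> prefix \<sigma> \<tau>" for \<sigma> \<tau>
    unfolding below_def using prefix_order.trans[of _ \<sigma> \<tau>] by auto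
  show ?thesis
  proof (intro exI[of _ d] conjI allI impI)
    show "pfun_enum_le (d \<sigma>) (d \<tau>) \<longleftrightarrow> prefix \<sigma> \<tau>" for \<sigma> \<tau>
      unfolding pfun_enum_le_def graph sub[symmetric]
      using columns_enum_le[OF _ fin] columns_subset_of_enum_le[OF G fin fin] by blast
    show "pfun_enum_le \<phi> (d (longest_common_prefix \<sigma> \<tau>))"
      if "pfun_enum_le \<phi> (d \<sigma>)" "pfun_enum_le \<phi> (d \<tau>)" for \<phi> \<sigma> \<tau>
      using that columns_meet[OF G fin fin] unfolding pfun_enum_le_def graph meet by blast
  qed
qed


section \<open>Kripke semantics of the intuitionistic propositional calculus\<close>

primrec forces :: "'w set \<Rightarrow> ('w \<Rightarrow> 'w \<Rightarrow> bool) \<Rightarrow> (nat \<Rightarrow> 'w set) \<Rightarrow> 'w \<Rightarrow> form \<Rightarrow> bool" where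
  "forces W R V w (Atom n) \<longleftrightarrow> w \<in> V n"
| "forces W R V w (Neg A) \<longleftrightarrow> (\<forall>u\<in>W. R w u \<longrightarrow> \<not> forces W R V u A)"
| "forces W R V w (Or A B) \<longleftrightarrow> forces W R V w A \<or> forces W R V w B"
| "forces W R V w (And A B) \<longleftrightarrow> forces W R V w A \<and> forces W R V w B"
| "forces W R V w (Imp A B) \<longleftrightarrow> (\<forall>u\<in>W. R w u \<longrightarrow> forces W R V u A \<longrightarrow> forces W R V u B)"

locale kripke_model =
  fixes W :: "'w set" and R :: "'w \<Rightarrow> 'w \<Rightarrow> bool" and V :: "nat \<Rightarrow> 'w set"
  assumes refl: "\<And>w. w \<in> W \<Longrightarrow> R w w"
    and trans: "\<And>w u v. w \<in> W \<Longrightarrow> u \<in> W \<Longrightarrow> v \<in> W \<Longrightarrow> R w u \<Longrightarrow> R u v \<Longrightarrow> R w v"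
    and persistent: "\<And>n w u. w \<in> W \<Longrightarrow> u \<in> W \<Longrightarrow> R w u \<Longrightarrow> w \<in> V n \<Longrightarrow> u \<in> V n"
begin

lemma forces_persistent:
  "w \<in> W \<Longrightarrow> u \<in> W \<Longrightarrow> R w u \<Longrightarrow> forces W R V w A \<Longrightarrow> forces W R V u A"
  by (induction A arbitrary: w u) (auto intro: persistent dest: trans)

theorem soundness: "A \<in> IPC \<Longrightarrow> w \<in> W \<Longrightarrow> forces W R V w A"
proof (induction A arbitrary: w rule: IPC.induct)
  case (K A B)
  then show ?case by (auto intro: forces_persistent)
next
  case (S A B C)
  show ?case
    unfolding forces.simps
  proof (intro ballI impI)
    fix u v x
    assume u: "u \<in> W" "R w u" "\<forall>y\<in>W. R u y \<longrightarrow> forces W R V y A \<longrightarrow>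
        (\<forall>z\<in>W. R y z \<longrightarrow> forces W R V z B \<longrightarrow> forces W R V z C)"
      and v: "v \<in> W" "R u v" "\<forall>y\<in>W. R v y \<longrightarrow> forces W R V y A \<longrightarrow> forces W R V y B"
      and x: "x \<in> W" "R v x" "forces W R V x A"
    have "R u x" using trans u(1) v(1,2) x(1,2) by blast
    moreover have "forces W R V x B" using v(3) x by blast
    ultimately show "forces W R V x C" using u(3) x refl by blast
  qed
next
  case (AndI A B)
  then show ?case by (auto intro: forces_persistent)
next
  case (OrE A C B)
  show ?case
    unfolding forces.simps
  proof (intro ballI impI)
    fix u v x
    assume "u \<in> W" "R w u" "\<forall>y\<in>W. R u y \<longrightarrow> forces W R V y A \<longrightarrow> forces W R V y C"
      and "v \<in> W" "R u v" "\<forall>y\<in>W. R v y \<longrightarrow> forces W R V y B \<longrightarrow> forces W R V y C"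
      and "x \<in> W" "R v x" "forces W R V x A \<or> forces W R V x B"
    then show "forces W R V x C" using trans by blast
  qed
next
  case (NegI A B)
  show ?case
    unfolding forces.simps
  proof (intro ballI impI notI)
    fix u v x
    assume u: "u \<in> W" "R w u" "\<forall>y\<in>W. R u y \<longrightarrow> forces W R V y A \<longrightarrow> forces W R V y B"
      and v: "v \<in> W" "R u v" "\<forall>y\<in>W. R v y \<longrightarrow> forces W R V y A \<longrightarrow> (\<forall>z\<in>W. R y z \<longrightarrow> \<not> forces W R V z B)"
      and x: "x \<in> W" "R v x" "forces W R V x A"
    have "R u x" using trans u(1) v(1,2) x(1,2) by blast
    then have "forces W R V x B" using u(3) x by blast
    then show False using v(3) x refl by blast
  qed
next
  case (NegE A B)
  show ?case by (auto intro: refl)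
next
  case (MP A B)
  then show ?case using refl by auto
qed auto

end

lemma forces_p_morphism:
  assumes "\<And>w. w \<in> W \<Longrightarrow> f w \<in> W'"
    and mono: "\<And>w u. w \<in> W \<Longrightarrow> u \<in> W \<Longrightarrow> R w u \<Longrightarrow> R' (f w) (f u)"
    and onto: "\<And>w v. w \<in> W \<Longrightarrow> v \<in> W' \<Longrightarrow> R' (f w) v \<Longrightarrow> \<exists>u\<in>W. R w u \<and> f u = v"
    and V: "\<And>n w. w \<in> W \<Longrightarrow> w \<in> V n \<longleftrightarrow> f w \<in> V' n"
  shows "w \<in> W \<Longrightarrow> forces W R V w A \<longleftrightarrow> forces W' R' V' (f w) A"
proof (induction A arbitrary: w)
  case (Neg A)
  then show ?case
    unfolding forces.simps using assms(1) mono onto by metis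
next
  case (Imp A B)
  then show ?case
    unfolding forces.simps using assms(1) mono onto by metis
qed (auto simp: V)


section \<open>Completeness for finite frames\<close>

inductive_set consequences :: "form set \<Rightarrow> form set" for \<Gamma> where
  hyp: "A \<in> \<Gamma> \<Longrightarrow> A \<in> consequences \<Gamma>"
| ipc: "A \<in> IPC \<Longrightarrow> A \<in> consequences \<Gamma>"
| mp: "Imp A B \<in> consequences \<Gamma> \<Longrightarrow> A \<in> consequences \<Gamma> \<Longrightarrow> B \<in> consequences \<Gamma>"

lemma consequences_empty: "consequences {} = IPC"
proof
  show "consequences {} \<subseteq> IPC"
  proof
    fix A assume "A \<in> consequences {}"
    then show "A \<in> IPC" by induction (auto intro: IPC.MP)
  qed
qed (auto intro: ipc)

lemma Imp_refl: "Imp A A \<in> IPC"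
  using IPC.MP[OF IPC.MP[OF IPC.S IPC.K] IPC.K[of A A]] by blast

lemma deduction: "B \<in> consequences (insert A \<Gamma>) \<Longrightarrow> Imp A B \<in> consequences \<Gamma>"
proof (induction rule: consequences.induct)
  case (hyp B)
  then show ?case
    using Imp_refl consequences.intros IPC.K by (metis insertE)
next
  case (ipc B)
  then show ?case using consequences.intros IPC.K by metis
next
  case (mp B C)
  then show ?case using consequences.mp[OF consequences.mp[OF consequences.ipc[OF IPC.S]]] by blast
qed

primrec subformulas :: "form \<Rightarrow> form set" where
  "subformulas (Atom n) = {Atom n}"
| "subformulas (Neg A) = insert (Neg A) (subformulas A)"
| "subformulas (Or A B) = insert (Or A B) (subformulas A \<union> subformulas B)"
| "subformulas (And A B) = insert (And A B) (subformulas A \<union> subformulas B)"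
| "subformulas (Imp A B) = insert (Imp A B) (subformulas A \<union> subformulas B)"

lemma finite_subformulas: "finite (subformulas A)"
  by (induction A) auto

lemma subformulas_refl: "A \<in> subformulas A"
  by (cases A) auto

lemma subformulas_trans: "B \<in> subformulas A \<Longrightarrow> subformulas B \<subseteq> subformulas A"
  by (induction A) auto

text \<open>
  The worlds of the canonical model for a finite set \<open>\<Sigma>\<close> of formulas are the traces on \<open>\<Sigma>\<close> of prime
  theories.
\<close>
definition prime_trace :: "form set \<Rightarrow> form set \<Rightarrow> bool" where
  "prime_trace \<Sigma> w \<longleftrightarrow> w \<subseteq> \<Sigma> \<and> consequences w \<inter> \<Sigma> \<subseteq> w \<and> consequences w \<noteq> UNIV \<and>
     (\<forall>A B. Or A B \<in> w \<longrightarrow> A \<in> w \<or> B \<in> w)"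

text \<open>
  Lindenbaum's construction: among the subsets of the finite set \<open>\<Sigma>\<close> that do not prove \<open>C\<close>, a maximal one
  is prime and closed under consequences in \<open>\<Sigma>\<close>.
\<close>
lemma prime_trace_extension:
  assumes "finite \<Sigma>" "\<Gamma> \<subseteq> \<Sigma>" "C \<notin> consequences \<Gamma>"
    and closed: "\<And>A. A \<in> \<Sigma> \<Longrightarrow> subformulas A \<subseteq> \<Sigma>"
  obtains w where "prime_trace \<Sigma> w" "\<Gamma> \<subseteq> w" "C \<notin> consequences w"
proof -
  let ?S = "{\<Delta>. \<Gamma> \<subseteq> \<Delta> \<and> \<Delta> \<subseteq> \<Sigma> \<and> C \<notin> consequences \<Delta>}"
  have "finite ?S"
    by (rule finite_subset[of _ "Pow \<Sigma>"]) (use assms(1) in auto)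
  moreover have "\<Gamma> \<in> ?S"
    using assms(2,3) by blast
  ultimately obtain w where w: "w \<in> ?S" and max: "\<And>\<Delta>. \<Delta> \<in> ?S \<Longrightarrow> w \<subseteq> \<Delta> \<Longrightarrow> \<Delta> = w"
    using finite_has_maximal[of ?S] by (metis (lifting) empty_iff)
  have step: "A \<in> w \<or> Imp A C \<in> consequences w" if "A \<in> \<Sigma>" for A
  proof (rule disjCI)
    assume "Imp A C \<notin> consequences w"
    then have "C \<notin> consequences (insert A w)"
      using deduction by blast
    then have "insert A w = w"
      using w that by (intro max) auto
    then show "A \<in> w" by blast
  qed
  have "A \<in> w" if "A \<in> consequences w" "A \<in> \<Sigma>" for A
    using step[OF that(2)] that(1) w consequences.mp by blast
  moreover have "A \<in> w \<or> B \<in> w" if "Or A B \<in> w" for A B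
  proof (rule ccontr)
    assume "\<not> (A \<in> w \<or> B \<in> w)"
    moreover have "A \<in> \<Sigma>" "B \<in> \<Sigma>"
      using that w closed[of "Or A B"] subformulas_refl[of A] subformulas_refl[of B] by auto
    ultimately have "Imp A C \<in> consequences w" "Imp B C \<in> consequences w"
      using step by blast+
    then have "C \<in> consequences w"
      using consequences.mp consequences.hyp[OF that] consequences.ipc[OF IPC.OrE] by metis
    then show False using w by blast
  qed
  ultimately have "prime_trace \<Sigma> w"
    using w unfolding prime_trace_def by blast
  with w show ?thesis
    by (intro that[of w]) auto
qed

lemma forces_prime_traces:
  assumes "finite \<Sigma>" and closed: "\<And>A. A \<in> \<Sigma> \<Longrightarrow> subformulas A \<subseteq> \<Sigma>"
  shows "prime_trace \<Sigma> w \<Longrightarrow> A \<in> \<Sigma> \<Longrightarrow>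
    forces (Collect (prime_trace \<Sigma>)) (\<subseteq>) (\<lambda>n. {w. Atom n \<in> w}) w A \<longleftrightarrow> A \<in> w"
proof (induction A arbitrary: w)
  case (Atom n)
  show ?case by simp
next
  case (Neg A)
  have A: "A \<in> \<Sigma>"
    using closed[OF Neg.prems(2)] subformulas_refl[of A] by auto
  show ?case
  proof
    assume "Neg A \<in> w"
    have "A \<notin> u" if "prime_trace \<Sigma> u" "w \<subseteq> u" for u
    proof
      assume "A \<in> u"
      then have "B \<in> consequences u" for B
        using \<open>Neg A \<in> w\<close> \<open>w \<subseteq> u\<close>
        by (blast intro: consequences.mp[OF consequences.mp[OF consequences.ipc[OF IPC.NegE]]] consequences.hyp)
      then show False
        using that(1) unfolding prime_trace_def by blast
    qed
    then show "forces (Collect (prime_trace \<Sigma>)) (\<subseteq>) (\<lambda>n. {w. Atom n \<in> w}) w (Neg A)"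
      using Neg.IH A by simp
  next
    assume f: "forces (Collect (prime_trace \<Sigma>)) (\<subseteq>) (\<lambda>n. {w. Atom n \<in> w}) w (Neg A)"
    show "Neg A \<in> w"
    proof (rule ccontr)
      assume "Neg A \<notin> w"
      then have notin: "Neg A \<notin> consequences w"
        using Neg.prems unfolding prime_trace_def by blast
      have "Neg A \<notin> consequences (insert A w)"
      proof
        assume "Neg A \<in> consequences (insert A w)"
        then have "Imp A (Neg A) \<in> consequences w"
          by (rule deduction)
        \<comment> \<open>\<open>A\<close> refutes itself: the instance \<open>B = A\<close> of the rule of negation introduction\<close>
        then have "Neg A \<in> consequences w"
          using consequences.mp consequences.ipc[OF IPC.NegI] consequences.ipc[OF Imp_refl] by metis
        with notin show False ..
      qed
      moreover have "insert A w \<subseteq> \<Sigma>"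
        using Neg.prems A unfolding prime_trace_def by blast
      ultimately obtain u where "prime_trace \<Sigma> u" "insert A w \<subseteq> u"
        using prime_trace_extension[OF assms(1) _ _ closed] by metis
      then show False
        using f Neg.IH A by auto
    qed
  qed
next
  case (Or A B)
  have AB: "A \<in> \<Sigma>" "B \<in> \<Sigma>"
    using closed[OF Or.prems(2)] subformulas_refl[of A] subformulas_refl[of B] by auto
  have "Or A B \<in> w \<longleftrightarrow> A \<in> w \<or> B \<in> w"
  proof
    assume "A \<in> w \<or> B \<in> w"
    then have "Or A B \<in> consequences w"
      by (blast intro: consequences.mp[OF consequences.ipc[OF IPC.OrI1]]
          consequences.mp[OF consequences.ipc[OF IPC.OrI2]] consequences.hyp)
    then show "Or A B \<in> w"
      using Or.prems unfolding prime_trace_def by blast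
  qed (use Or.prems in \<open>auto simp: prime_trace_def\<close>)
  then show ?case
    using Or AB by simp
next
  case (And A B)
  have AB: "A \<in> \<Sigma>" "B \<in> \<Sigma>"
    using closed[OF And.prems(2)] subformulas_refl[of A] subformulas_refl[of B] by auto
  have "And A B \<in> w \<longleftrightarrow> A \<in> w \<and> B \<in> w"
  proof
    assume "A \<in> w \<and> B \<in> w"
    then have "And A B \<in> consequences w"
      by (blast intro: consequences.mp[OF consequences.mp[OF consequences.ipc[OF IPC.AndI]]] consequences.hyp)
    then show "And A B \<in> w"
      using And.prems unfolding prime_trace_def by blast
  next
    assume "And A B \<in> w"
    then have "A \<in> consequences w" "B \<in> consequences w"
      by (blast intro: consequences.mp[OF consequences.ipc[OF IPC.AndE1]]
          consequences.mp[OF consequences.ipc[OF IPC.AndE2]] consequences.hyp)+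
    then show "A \<in> w \<and> B \<in> w"
      using And.prems AB unfolding prime_trace_def by blast
  qed
  then show ?case
    using And AB by simp
next
  case (Imp A B)
  have AB: "A \<in> \<Sigma>" "B \<in> \<Sigma>"
    using closed[OF Imp.prems(2)] subformulas_refl[of A] subformulas_refl[of B] by auto
  show ?case
  proof
    assume "Imp A B \<in> w"
    have "B \<in> u" if "prime_trace \<Sigma> u" "w \<subseteq> u" "A \<in> u" for u
    proof -
      have "B \<in> consequences u"
        using that \<open>Imp A B \<in> w\<close> by (blast intro: consequences.mp consequences.hyp)
      then show ?thesis
        using that(1) AB unfolding prime_trace_def by blast
    qed
    then show "forces (Collect (prime_trace \<Sigma>)) (\<subseteq>) (\<lambda>n. {w. Atom n \<in> w}) w (Imp A B)"
      using Imp.IH AB by simp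
  next
    assume f: "forces (Collect (prime_trace \<Sigma>)) (\<subseteq>) (\<lambda>n. {w. Atom n \<in> w}) w (Imp A B)"
    show "Imp A B \<in> w"
    proof (rule ccontr)
      assume "Imp A B \<notin> w"
      then have "Imp A B \<notin> consequences w"
        using Imp.prems unfolding prime_trace_def by blast
      then have "B \<notin> consequences (insert A w)"
        using deduction by blast
      moreover have "insert A w \<subseteq> \<Sigma>"
        using Imp.prems AB unfolding prime_trace_def by blast
      ultimately obtain u where u: "prime_trace \<Sigma> u" "insert A w \<subseteq> u" "B \<notin> consequences u"
        using prime_trace_extension[OF assms(1) _ _ closed] by metis
      then have "B \<notin> u"
        using consequences.hyp by blast
      then show False
        using f Imp.IH AB u(1,2) by auto
    qed
  qed
qed

theorem finite_countermodel:
  assumes "A \<notin> IPC"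
  shows "\<exists>(W :: form set set) V w. finite W \<and> w \<in> W \<and> kripke_model W (\<subseteq>) V \<and> \<not> forces W (\<subseteq>) V w A"
proof -
  let ?\<Sigma> = "subformulas A"
  have "A \<notin> consequences {}"
    using assms consequences_empty by blast
  then obtain w where w: "prime_trace ?\<Sigma> w" "A \<notin> consequences w"
    using prime_trace_extension[OF finite_subformulas _ _ subformulas_trans, of "{}"] by blast
  show ?thesis
  proof (intro exI conjI)
    show "finite (Collect (prime_trace ?\<Sigma>))"
      by (rule finite_subset[of _ "Pow ?\<Sigma>"]) (auto simp: prime_trace_def finite_subformulas)
    show "kripke_model (Collect (prime_trace ?\<Sigma>)) (\<subseteq>) (\<lambda>n. {w. Atom n \<in> w})"
      by unfold_locales auto
    show "\<not> forces (Collect (prime_trace ?\<Sigma>)) (\<subseteq>) (\<lambda>n. {w. Atom n \<in> w}) w A"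
      using forces_prime_traces[OF finite_subformulas subformulas_trans w(1) subformulas_refl]
        w(2) consequences.hyp by blast
  qed (use w in simp)
qed

text \<open>
  A sequence of numbers is read as a sequence of requests to move to the world with that number; requests
  for worlds that are not accessible are ignored.
\<close>
lemma p_morphism_from_sequences:
  assumes "countable W" "w0 \<in> W"
    and refl: "\<And>w. w \<in> W \<Longrightarrow> R w w"
    and trans: "\<And>w u v. w \<in> W \<Longrightarrow> u \<in> W \<Longrightarrow> v \<in> W \<Longrightarrow> R w u \<Longrightarrow> R u v \<Longrightarrow> R w v"
  shows "\<exists>g :: nat list \<Rightarrow> 'w. g [] = w0 \<and> range g \<subseteq> W \<and> (\<forall>\<sigma> \<tau>. prefix \<sigma> \<tau> \<longrightarrow> R (g \<sigma>) (g \<tau>)) \<and>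
    (\<forall>\<sigma>. \<forall>v\<in>W. R (g \<sigma>) v \<longrightarrow> (\<exists>\<tau>. prefix \<sigma> \<tau> \<and> g \<tau> = v))"
proof -
  define e where "e = from_nat_into W"
  have e: "range e = W"
    unfolding e_def using assms(1,2) by (intro range_from_nat_into) auto
  define move where "move w n = (if R w (e n) then e n else w)" for w n
  have move: "foldl move w \<sigma> \<in> W \<and> R w (foldl move w \<sigma>)" if "w \<in> W" for w \<sigma>
    using that
  proof (induction \<sigma> rule: rev_induct)
    case (snoc n \<sigma>)
    then have "e n \<in> W" "foldl move w \<sigma> \<in> W" "R w (foldl move w \<sigma>)"
      using e by auto
    then show ?case
      using trans[OF snoc.prems, of "foldl move w \<sigma>" "e n"] by (simp add: move_def[of "foldl move w \<sigma>"])
  qed (simp add: refl)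
  show ?thesis
  proof (intro exI[of _ "foldl move w0"] conjI allI ballI impI)
    show "range (foldl move w0) \<subseteq> W"
      using move assms(2) by blast
    then have "R (foldl move w0 \<sigma>) (foldl move (foldl move w0 \<sigma>) \<rho>)" for \<sigma> \<rho>
      using move[of "foldl move w0 \<sigma>" \<rho>] by blast
    then show "R (foldl move w0 \<sigma>) (foldl move w0 \<tau>)" if "prefix \<sigma> \<tau>" for \<sigma> \<tau>
      using that by (auto elim!: prefixE)
    show "\<exists>\<tau>. prefix \<sigma> \<tau> \<and> foldl move w0 \<tau> = v" if "v \<in> W" "R (foldl move w0 \<sigma>) v" for \<sigma> v
    proof -
      obtain n where "v = e n" using \<open>v \<in> W\<close> e by blast
      with that show ?thesis
        by (intro exI[of _ "\<sigma> @ [n]"]) (simp add: move_def[of "foldl move w0 \<sigma>"])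
    qed
  qed simp
qed


section \<open>Lattices of up-sets\<close>

text \<open>
  The elements of the lattice are named by the up-sets that include \<open>Z\<close>, larger sets lying lower. Keeping
  \<open>Z\<close> inside the up-sets, instead of removing it from all of them, lets the same naming serve the whole
  lattice (\<open>Z = {}\<close>) and its initial segments.
\<close>
locale upset_lattice =
  fixes L :: "'a gorder" and cls :: "'w set \<Rightarrow> 'a" and R :: "'w \<Rightarrow> 'w \<Rightarrow> bool" and Z :: "'w set"
    and upsets :: "'w set set"
  defines "upsets \<equiv> {X. Z \<subseteq> X \<and> (\<forall>w\<in>X. \<forall>u. R w u \<longrightarrow> u \<in> X)}"
  assumes R_refl: "\<And>w. R w w"
    and R_trans: "\<And>w u v. R w u \<Longrightarrow> R u v \<Longrightarrow> R w v"
    and Z: "Z \<in> upsets"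
    and eq_eq: "eq L = (=)"
    and carrier_eq: "carrier L = cls ` upsets"
    and le_iff: "\<And>X Y. X \<in> upsets \<Longrightarrow> Y \<in> upsets \<Longrightarrow> cls X \<sqsubseteq>\<^bsub>L\<^esub> cls Y \<longleftrightarrow> Y \<subseteq> X"
begin

lemma cls_eq_iff: "X \<in> upsets \<Longrightarrow> Y \<in> upsets \<Longrightarrow> cls X = cls Y \<longleftrightarrow> X = Y"
  using le_iff by (metis subset_antisym order_refl)

lemma upsets_UNIV: "UNIV \<in> upsets"
  unfolding upsets_def by blast

lemma upsets_Int: "X \<in> upsets \<Longrightarrow> Y \<in> upsets \<Longrightarrow> X \<inter> Y \<in> upsets"
  unfolding upsets_def by blast

lemma upsets_Un: "X \<in> upsets \<Longrightarrow> Y \<in> upsets \<Longrightarrow> X \<union> Y \<in> upsets"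
  unfolding upsets_def by blast

definition imp_set :: "'w set \<Rightarrow> 'w set \<Rightarrow> 'w set" where
  "imp_set X Y = {w. \<forall>u. R w u \<longrightarrow> u \<in> X \<longrightarrow> u \<in> Y}"

lemma upsets_imp_set:
  assumes "Y \<in> upsets"
  shows "imp_set X Y \<in> upsets"
  using assms Z R_trans unfolding upsets_def imp_set_def by blast

lemma least_cls_iff:
  assumes "X \<in> upsets" "S \<subseteq> upsets"
  shows "least L (cls X) (cls ` S) \<longleftrightarrow> X \<in> S \<and> (\<forall>Y\<in>S. Y \<subseteq> X)"
proof -
  have "cls X \<in> cls ` S \<longleftrightarrow> X \<in> S"
    using assms cls_eq_iff by blast
  moreover have "cls ` S \<subseteq> carrier L"
    using assms(2) carrier_eq by blast
  moreover have "(\<forall>x\<in>cls ` S. cls X \<sqsubseteq>\<^bsub>L\<^esub> x) \<longleftrightarrow> (\<forall>Y\<in>S. Y \<subseteq> X)"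
    using assms le_iff by blast
  ultimately show ?thesis
    unfolding least_def by blast
qed

lemma greatest_cls_iff:
  assumes "X \<in> upsets" "S \<subseteq> upsets"
  shows "greatest L (cls X) (cls ` S) \<longleftrightarrow> X \<in> S \<and> (\<forall>Y\<in>S. X \<subseteq> Y)"
proof -
  have "cls X \<in> cls ` S \<longleftrightarrow> X \<in> S"
    using assms cls_eq_iff by blast
  moreover have "cls ` S \<subseteq> carrier L"
    using assms(2) carrier_eq by blast
  moreover have "(\<forall>x\<in>cls ` S. x \<sqsubseteq>\<^bsub>L\<^esub> cls X) \<longleftrightarrow> (\<forall>Y\<in>S. X \<subseteq> Y)"
    using assms le_iff by blast
  ultimately show ?thesis
    unfolding greatest_def by blast
qed

lemma some_least:
  assumes "X \<in> upsets" "S \<subseteq> upsets" "X \<in> S" "\<And>Y. Y \<in> S \<Longrightarrow> Y \<subseteq> X"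
  shows "(SOME x. least L x (cls ` S)) = cls X"
proof (rule some_equality)
  show "least L (cls X) (cls ` S)"
    using least_cls_iff assms by blast
  fix x assume "least L x (cls ` S)"
  then obtain Y where Y: "x = cls Y" "Y \<in> S" "\<forall>Y'\<in>S. Y' \<subseteq> Y"
    using least_cls_iff assms(2) unfolding least_def by blast
  then have "Y = X"
    using assms(3) assms(4)[of Y] by blast
  then show "x = cls X"
    using Y(1) by simp
qed

lemma some_greatest:
  assumes "X \<in> upsets" "S \<subseteq> upsets" "X \<in> S" "\<And>Y. Y \<in> S \<Longrightarrow> X \<subseteq> Y"
  shows "(SOME x. greatest L x (cls ` S)) = cls X"
proof (rule some_equality)
  show "greatest L (cls X) (cls ` S)"
    using greatest_cls_iff assms by blast
  fix x assume "greatest L x (cls ` S)"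
  then obtain Y where Y: "x = cls Y" "Y \<in> S" "\<forall>Y'\<in>S. Y \<subseteq> Y'"
    using greatest_cls_iff assms(2) unfolding greatest_def by blast
  then have "Y = X"
    using assms(3) assms(4)[of Y] by blast
  then show "x = cls X"
    using Y(1) by simp
qed

lemma bottom_eq: "\<bottom>\<^bsub>L\<^esub> = cls UNIV"
  unfolding bottom_def carrier_eq using upsets_UNIV by (intro some_least) auto

lemma top_eq: "\<top>\<^bsub>L\<^esub> = cls Z"
  unfolding top_def carrier_eq using Z by (intro some_greatest) (auto simp: upsets_def)

lemma Upper_cls:
  assumes "X \<in> upsets" "Y \<in> upsets"
  shows "Upper L {cls X, cls Y} = cls ` {W \<in> upsets. W \<subseteq> X \<inter> Y}"
  unfolding Upper_def carrier_eq using assms le_iff by auto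

lemma Lower_cls:
  assumes "X \<in> upsets" "Y \<in> upsets"
  shows "Lower L {cls X, cls Y} = cls ` {W \<in> upsets. X \<union> Y \<subseteq> W}"
  unfolding Lower_def carrier_eq using assms le_iff by auto

lemma join_eq: "X \<in> upsets \<Longrightarrow> Y \<in> upsets \<Longrightarrow> cls X \<squnion>\<^bsub>L\<^esub> cls Y = cls (X \<inter> Y)"
  unfolding join_def sup_def Upper_cls by (intro some_least) (auto intro: upsets_Int)

lemma meet_eq: "X \<in> upsets \<Longrightarrow> Y \<in> upsets \<Longrightarrow> cls X \<sqinter>\<^bsub>L\<^esub> cls Y = cls (X \<union> Y)"
  unfolding meet_def inf_def Lower_cls by (intro some_greatest) (auto intro: upsets_Un)

lemma residual_set:
  assumes "X \<in> upsets" "Y \<in> upsets"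
  shows "{c \<in> carrier L. cls Y \<sqsubseteq>\<^bsub>L\<^esub> cls X \<squnion>\<^bsub>L\<^esub> c} = cls ` {W \<in> upsets. X \<inter> W \<subseteq> Y}"
  unfolding carrier_eq using assms join_eq le_iff upsets_Int by auto

lemma subset_imp_set:
  assumes "W \<in> upsets" "X \<inter> W \<subseteq> Y"
  shows "W \<subseteq> imp_set X Y"
  using assms unfolding upsets_def imp_set_def by blast

lemma Int_imp_set: "X \<inter> imp_set X Y \<subseteq> Y"
  unfolding imp_set_def using R_refl by blast

lemma imp_eq:
  assumes "X \<in> upsets" "Y \<in> upsets"
  shows "brouwer_imp L (cls X) (cls Y) = cls (imp_set X Y)"
  unfolding brouwer_imp_def residual_set[OF assms]
proof (rule some_least)
  show "imp_set X Y \<in> upsets" "imp_set X Y \<in> {W \<in> upsets. X \<inter> W \<subseteq> Y}"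
    using upsets_imp_set[OF assms(2)] Int_imp_set by simp_all
  show "W \<subseteq> imp_set X Y" if "W \<in> {W \<in> upsets. X \<inter> W \<subseteq> Y}" for W
    using that subset_imp_set by simp
qed simp

lemma partial_order_L: "partial_order L"
proof (unfold_locales, unfold eq_eq carrier_eq)
  show "x = y" if "x \<sqsubseteq>\<^bsub>L\<^esub> y" "y \<sqsubseteq>\<^bsub>L\<^esub> x" "x \<in> cls ` upsets" "y \<in> cls ` upsets" for x y
    using that by (auto simp: le_iff)
  show "x \<sqsubseteq>\<^bsub>L\<^esub> z" if "x \<sqsubseteq>\<^bsub>L\<^esub> y" "y \<sqsubseteq>\<^bsub>L\<^esub> z" "x \<in> cls ` upsets" "y \<in> cls ` upsets" "z \<in> cls ` upsets"
    for x y z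
    using that by (auto simp: le_iff)
qed (auto simp: le_iff)

theorem brouwer_algebra_L:
  assumes "Z \<noteq> UNIV"
  shows "brouwer_algebra L"
proof -
  interpret partial_order L by (rule partial_order_L)
  show ?thesis
  proof unfold_locales
    show "\<exists>s. least L s (Upper L {x, y})" if xy: "x \<in> carrier L" "y \<in> carrier L" for x y
    proof -
      obtain X Y where XY: "X \<in> upsets" "Y \<in> upsets" "x = cls X" "y = cls Y"
        using xy carrier_eq by blast
      then have "least L (cls (X \<inter> Y)) (Upper L {x, y})"
        by (simp add: Upper_cls least_cls_iff upsets_Int)
      then show ?thesis ..
    qed
    show "\<exists>s. greatest L s (Lower L {x, y})" if xy: "x \<in> carrier L" "y \<in> carrier L" for x y
    proof -
      obtain X Y where XY: "X \<in> upsets" "Y \<in> upsets" "x = cls X" "y = cls Y"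
        using xy carrier_eq by blast
      then have "greatest L (cls (X \<union> Y)) (Lower L {x, y})"
        by (simp add: Lower_cls greatest_cls_iff upsets_Un)
      then show ?thesis ..
    qed
    show "\<exists>x. least L x (carrier L)"
      using least_cls_iff[OF upsets_UNIV order_refl] upsets_UNIV carrier_eq by auto
    show "\<exists>x. greatest L x (carrier L)"
      using greatest_cls_iff[OF Z order_refl] Z carrier_eq unfolding upsets_def by auto
    show "\<bottom>\<^bsub>L\<^esub> \<noteq> \<top>\<^bsub>L\<^esub>"
      using assms cls_eq_iff[OF upsets_UNIV Z] by (simp add: bottom_eq top_eq)
    show "\<exists>x. least L x {c \<in> carrier L. b \<sqsubseteq>\<^bsub>L\<^esub> a \<squnion>\<^bsub>L\<^esub> c}"
      if ab: "a \<in> carrier L" "b \<in> carrier L" for a b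
    proof -
      obtain X Y where XY: "X \<in> upsets" "Y \<in> upsets" "a = cls X" "b = cls Y"
        using ab carrier_eq by blast
      then have "least L (cls (imp_set X Y)) {c \<in> carrier L. b \<sqsubseteq>\<^bsub>L\<^esub> a \<squnion>\<^bsub>L\<^esub> c}"
        using upsets_imp_set subset_imp_set Int_imp_set by (simp add: residual_set least_cls_iff)
      then show ?thesis ..
    qed
  qed
qed

text \<open>
  Truth is the least element, named by the largest up-set, so the up-set naming the value of a formula
  consists of the worlds where it is forced, together with \<open>Z\<close>; falsity is the greatest element, named by
  \<open>Z\<close> itself, which no world of the frame belongs to.
\<close>
lemma form_eval_eq_forces:
  assumes U: "\<And>n. U n \<in> upsets"
  shows "{w. w \<in> Z \<or> forces (- Z) R U w A} \<in> upsets \<and>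
    form_eval L (\<lambda>n. cls (U n)) A = cls {w. w \<in> Z \<or> forces (- Z) R U w A}"
proof (induction A)
  case (Atom n)
  have "{w. w \<in> Z \<or> w \<in> U n} = U n"
    using U[of n] unfolding upsets_def by blast
  then show ?case using U by simp
next
  case (Neg A)
  let ?X = "{w. w \<in> Z \<or> forces (- Z) R U w A}"
  have "imp_set ?X Z = {w. w \<in> Z \<or> forces (- Z) R U w (Neg A)}"
    using Z unfolding imp_set_def upsets_def by auto
  then show ?case
    using Neg imp_eq[of ?X Z] upsets_imp_set[OF Z, of ?X] Z by (simp add: top_eq)
next
  case (Or A B)
  let ?X = "{w. w \<in> Z \<or> forces (- Z) R U w A}" and ?Y = "{w. w \<in> Z \<or> forces (- Z) R U w B}"
  have "?X \<union> ?Y = {w. w \<in> Z \<or> forces (- Z) R U w (Or A B)}"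
    by auto
  then show ?case
    using Or meet_eq[of ?X ?Y] upsets_Un[of ?X ?Y] by simp
next
  case (And A B)
  let ?X = "{w. w \<in> Z \<or> forces (- Z) R U w A}" and ?Y = "{w. w \<in> Z \<or> forces (- Z) R U w B}"
  have "?X \<inter> ?Y = {w. w \<in> Z \<or> forces (- Z) R U w (And A B)}"
    by auto
  then show ?case
    using And join_eq[of ?X ?Y] upsets_Int[of ?X ?Y] by simp
next
  case (Imp A B)
  let ?X = "{w. w \<in> Z \<or> forces (- Z) R U w A}" and ?Y = "{w. w \<in> Z \<or> forces (- Z) R U w B}"
  have "imp_set ?X ?Y = {w. w \<in> Z \<or> forces (- Z) R U w (Imp A B)}"
    using Z unfolding imp_set_def upsets_def by auto
  then show ?case
    using Imp imp_eq[of ?X ?Y] upsets_imp_set[of ?Y ?X] by simp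
qed

theorem Th_eq_forced: "Th L = {A. \<forall>U. (\<forall>n. U n \<in> upsets) \<longrightarrow> (\<forall>w. w \<notin> Z \<longrightarrow> forces (- Z) R U w A)}"
proof -
  have valid: "form_eval L (\<lambda>n. cls (U n)) A = \<bottom>\<^bsub>L\<^esub> \<longleftrightarrow> (\<forall>w. w \<notin> Z \<longrightarrow> forces (- Z) R U w A)"
    if "\<And>n. U n \<in> upsets" for U A
    using form_eval_eq_forces[of U A] that cls_eq_iff[OF _ upsets_UNIV] by (auto simp: bottom_eq)
  have range: "range v \<subseteq> carrier L \<longleftrightarrow> (\<exists>U. (\<forall>n. U n \<in> upsets) \<and> v = (\<lambda>n. cls (U n)))" for v :: "nat \<Rightarrow> 'a"
  proof
    assume "range v \<subseteq> carrier L"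
    then have "\<forall>n. \<exists>X. X \<in> upsets \<and> v n = cls X"
      unfolding carrier_eq by blast
    then show "\<exists>U. (\<forall>n. U n \<in> upsets) \<and> v = (\<lambda>n. cls (U n))"
      by metis
  qed (auto simp: carrier_eq)
  show ?thesis
    unfolding Th_def range using valid by blast
qed

end


section \<open>The Dyment-Muchnik lattice as a lattice of up-sets\<close>

abbreviation pfun_upset :: "(nat \<rightharpoonup> nat) set \<Rightarrow> bool" where
  "pfun_upset X \<equiv> \<forall>\<phi>\<in>X. \<forall>\<psi>. pfun_enum_le \<phi> \<psi> \<longrightarrow> \<psi> \<in> X"

definition upward :: "D_mass_problem \<Rightarrow> D_mass_problem" where
  "upward A = {\<psi>. \<exists>\<phi>\<in>A. pfun_enum_le \<phi> \<psi>}"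

text \<open>
  For an up-set \<open>X\<close> this is the degree of \<open>X\<close>, since a mass problem is equivalent to its upward closure.
\<close>
definition upset_class :: "D_mass_problem \<Rightarrow> D_mass_problem set" where
  "upset_class X = {A. upward A = X}"

lemma upward_upset: "pfun_upset (upward A)"
  unfolding upward_def using pfun_enum_le_trans by blast

lemma upward_of_upset: "pfun_upset X \<Longrightarrow> upward X = X"
  unfolding upward_def using pfun_enum_le_refl by blast

lemma Dw_le_iff: "Dw_le A B \<longleftrightarrow> upward B \<subseteq> upward A"
  unfolding Dw_le_def upward_def using pfun_enum_le_refl pfun_enum_le_trans by blast

lemma carrier_M_Dw: "carrier M_Dw = upset_class ` {X. pfun_upset X}"
proof -
  have "Dw_equiv `` {A} = upset_class (upward A)" for A
    unfolding Dw_equiv_def upset_class_def Dw_le_iff by auto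
  then have "carrier M_Dw = range (\<lambda>A. upset_class (upward A))"
    unfolding M_Dw_def quotient_def by auto
  also have "\<dots> = upset_class ` {X. pfun_upset X}"
    using upward_upset upward_of_upset by (auto simp: image_iff) metis
  finally show ?thesis .
qed

lemma le_M_Dw:
  assumes "pfun_upset X" "pfun_upset Y"
  shows "upset_class X \<sqsubseteq>\<^bsub>M_Dw\<^esub> upset_class Y \<longleftrightarrow> Y \<subseteq> X"
  using upward_of_upset[OF assms(1)] upward_of_upset[OF assms(2)]
  unfolding M_Dw_def upset_class_def by (auto simp: Dw_le_iff)

lemma upset_lattice_M_Dw: "upset_lattice M_Dw upset_class pfun_enum_le {}"
  by unfold_locales
    (use pfun_enum_le_refl pfun_enum_le_trans carrier_M_Dw le_M_Dw in \<open>auto simp: M_Dw_def\<close>)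

lemma bottom_M_Dw: "\<bottom>\<^bsub>M_Dw\<^esub> = upset_class UNIV"
  by (rule upset_lattice.bottom_eq[OF upset_lattice_M_Dw])

lemma upset_lattice_initial_segment:
  assumes Z: "pfun_upset Z"
  shows "upset_lattice (initial_segment M_Dw (upset_class Z)) upset_class pfun_enum_le Z"
proof unfold_locales
  have "\<lbrace>\<bottom>\<^bsub>M_Dw\<^esub>..upset_class Z\<rbrace>\<^bsub>M_Dw\<^esub> = upset_class ` {X. Z \<subseteq> X \<and> pfun_upset X}"
    unfolding at_least_at_most_def bottom_M_Dw carrier_M_Dw using le_M_Dw[OF _ Z] le_M_Dw[of UNIV] by auto
  then show "carrier (initial_segment M_Dw (upset_class Z)) = upset_class ` {X. Z \<subseteq> X \<and> pfun_upset X}"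
    unfolding initial_segment_def by simp
qed (use assms pfun_enum_le_refl pfun_enum_le_trans le_M_Dw in \<open>auto simp: initial_segment_def M_Dw_def\<close>)


section \<open>An initial segment capturing the intuitionistic propositional calculus\<close>

text \<open>
  Among the nodes above a given partial function, one of minimal length is least, by preservation of meets.
  Sending the function to this node yields a p-morphism: in the back condition for a node \<open>\<tau>\<close>, the witness is \<open>d \<tau>\<close>.
\<close>
lemma p_morphism_to_tree:
  fixes d :: "nat list \<Rightarrow> nat \<rightharpoonup> nat"
  assumes d_le: "\<And>\<sigma> \<tau>. pfun_enum_le (d \<sigma>) (d \<tau>) \<longleftrightarrow> prefix \<sigma> \<tau>"
    and d_meet: "\<And>\<phi> \<sigma> \<tau>. pfun_enum_le \<phi> (d \<sigma>) \<Longrightarrow> pfun_enum_le \<phi> (d \<tau>) \<Longrightarrow>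
      pfun_enum_le \<phi> (d (longest_common_prefix \<sigma> \<tau>))"
    and P: "P = {\<phi>. \<exists>\<sigma>. pfun_enum_le \<phi> (d \<sigma>)}"
  shows "\<exists>f. (\<forall>\<sigma>. f (d \<sigma>) = \<sigma>) \<and>
    (\<forall>\<psi>\<in>P. \<forall>\<phi>. pfun_enum_le \<phi> \<psi> \<longrightarrow> prefix (f \<phi>) (f \<psi>)) \<and>
    (\<forall>\<phi>\<in>P. \<forall>\<tau>. prefix (f \<phi>) \<tau> \<longrightarrow> pfun_enum_le \<phi> (d \<tau>))"
proof -
  have "\<exists>\<sigma>. pfun_enum_le \<phi> (d \<sigma>) \<and> (\<forall>\<tau>. pfun_enum_le \<phi> (d \<tau>) \<longrightarrow> prefix \<sigma> \<tau>)" if \<phi>: "\<phi> \<in> P" for \<phi>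
  proof -
    obtain \<sigma> where \<sigma>: "pfun_enum_le \<phi> (d \<sigma>)"
      and min: "\<And>\<tau>. pfun_enum_le \<phi> (d \<tau>) \<Longrightarrow> length \<sigma> \<le> length \<tau>"
      using \<phi> ex_has_least_nat[of "\<lambda>\<sigma>. pfun_enum_le \<phi> (d \<sigma>)" _ length] unfolding P by blast
    have "prefix \<sigma> \<tau>" if "pfun_enum_le \<phi> (d \<tau>)" for \<tau>
    proof -
      have len: "length \<sigma> \<le> length (longest_common_prefix \<sigma> \<tau>)"
        using d_meet[OF \<sigma> that] by (rule min)
      obtain \<rho> where \<rho>: "longest_common_prefix \<sigma> \<tau> @ \<rho> = \<sigma>"
        using longest_common_prefix_prefix1[of \<sigma> \<tau>] unfolding prefix_def by metis
      have "length \<rho> = 0"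
        using len arg_cong[OF \<rho>, of length] unfolding length_append by linarith
      with \<rho> have "longest_common_prefix \<sigma> \<tau> = \<sigma>"
        by simp
      then show ?thesis
        using longest_common_prefix_prefix2[of \<sigma> \<tau>] by simp
    qed
    with \<sigma> show ?thesis by blast
  qed
  then have "\<exists>f. \<forall>\<phi>\<in>P. pfun_enum_le \<phi> (d (f \<phi>)) \<and> (\<forall>\<tau>. pfun_enum_le \<phi> (d \<tau>) \<longrightarrow> prefix (f \<phi>) \<tau>)"
    by (intro bchoice) blast
  then obtain f where f: "\<And>\<phi>. \<phi> \<in> P \<Longrightarrow> pfun_enum_le \<phi> (d (f \<phi>))"
    and f_least: "\<And>\<phi> \<tau>. \<phi> \<in> P \<Longrightarrow> pfun_enum_le \<phi> (d \<tau>) \<Longrightarrow> prefix (f \<phi>) \<tau>"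
    by blast
  have dP: "d \<sigma> \<in> P" for \<sigma>
    unfolding P using pfun_enum_le_refl by blast
  show ?thesis
  proof (intro exI[of _ f] conjI allI ballI impI)
    show "f (d \<sigma>) = \<sigma>" for \<sigma>
      using f[OF dP] f_least[OF dP pfun_enum_le_refl] d_le prefix_order.antisym by blast
    show "prefix (f \<phi>) (f \<psi>)" if "\<psi> \<in> P" "pfun_enum_le \<phi> \<psi>" for \<phi> \<psi>
    proof -
      have "pfun_enum_le \<phi> (d (f \<psi>))"
        using pfun_enum_le_trans[OF that(2) f[OF that(1)]] .
      then show ?thesis
        using f_least unfolding P by blast
    qed
    show "pfun_enum_le \<phi> (d \<tau>)" if "\<phi> \<in> P" "prefix (f \<phi>) \<tau>" for \<phi> \<tau>
      using pfun_enum_le_trans f[OF that(1)] that(2) d_le by blast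
  qed
qed

theorem mainTheorem2:
  shows "\<exists>Z \<in> carrier M_Dw. Z \<noteq> \<bottom>\<^bsub>M_Dw\<^esub> \<and>
           brouwer_algebra (initial_segment M_Dw Z) \<and>
           Th (initial_segment M_Dw Z) = IPC"
proof -
  obtain d :: "nat list \<Rightarrow> nat \<rightharpoonup> nat"
    where d_le: "\<And>\<sigma> \<tau>. pfun_enum_le (d \<sigma>) (d \<tau>) \<longleftrightarrow> prefix \<sigma> \<tau>"
      and d_meet: "\<And>\<phi> \<sigma> \<tau>. pfun_enum_le \<phi> (d \<sigma>) \<Longrightarrow> pfun_enum_le \<phi> (d \<tau>) \<Longrightarrow>
        pfun_enum_le \<phi> (d (longest_common_prefix \<sigma> \<tau>))"
    using enum_degree_tree by blast
  define P where "P = {\<phi>. \<exists>\<sigma>. pfun_enum_le \<phi> (d \<sigma>)}"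
  obtain f where f_d: "\<And>\<sigma>. f (d \<sigma>) = \<sigma>"
    and f_mono: "\<And>\<phi> \<psi>. \<psi> \<in> P \<Longrightarrow> pfun_enum_le \<phi> \<psi> \<Longrightarrow> prefix (f \<phi>) (f \<psi>)"
    and f_onto: "\<And>\<phi> \<tau>. \<phi> \<in> P \<Longrightarrow> prefix (f \<phi>) \<tau> \<Longrightarrow> pfun_enum_le \<phi> (d \<tau>)"
    using p_morphism_to_tree[OF d_le d_meet P_def] by blast
  have dP: "d \<sigma> \<in> P" for \<sigma>
    unfolding P_def using pfun_enum_le_refl by blast
  have up: "pfun_upset (- P)"
    unfolding P_def using pfun_enum_le_trans by blast
  let ?L = "initial_segment M_Dw (upset_class (- P))"
  interpret upset_lattice ?L upset_class pfun_enum_le "- P"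
    "{X. - P \<subseteq> X \<and> pfun_upset X}"
    using upset_lattice_initial_segment[OF up] by simp
  have "- P \<noteq> UNIV"
    using dP by blast
  have "Th ?L = IPC"
  proof
    show "IPC \<subseteq> Th ?L"
    proof
      fix A assume "A \<in> IPC"
      have "forces P pfun_enum_le U \<phi> A" if "\<forall>n. - P \<subseteq> U n \<and> pfun_upset (U n)" "\<phi> \<in> P" for U \<phi>
      proof -
        interpret kripke_model P pfun_enum_le U
          using that(1) pfun_enum_le_refl pfun_enum_le_trans by unfold_locales blast+
        show ?thesis using \<open>A \<in> IPC\<close> that(2) by (rule soundness)
      qed
      then show "A \<in> Th ?L"
        unfolding Th_eq_forced by simp
    qed
    show "Th ?L \<subseteq> IPC"
    proof (rule subsetI, rule ccontr)
      fix A assume A: "A \<in> Th ?L" and "A \<notin> IPC"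
      then obtain W :: "form set set" and V w0
        where W: "finite W" "w0 \<in> W" "kripke_model W (\<subseteq>) V" "\<not> forces W (\<subseteq>) V w0 A"
        using finite_countermodel by blast
      have "\<exists>g :: nat list \<Rightarrow> form set. g [] = w0 \<and> range g \<subseteq> W \<and> (\<forall>\<sigma> \<tau>. prefix \<sigma> \<tau> \<longrightarrow> g \<sigma> \<subseteq> g \<tau>) \<and>
          (\<forall>\<sigma>. \<forall>v\<in>W. g \<sigma> \<subseteq> v \<longrightarrow> (\<exists>\<tau>. prefix \<sigma> \<tau> \<and> g \<tau> = v))"
        by (rule p_morphism_from_sequences) (use W countable_finite in auto)
      then obtain g :: "nat list \<Rightarrow> form set"
        where g: "g [] = w0" "range g \<subseteq> W" "\<forall>\<sigma> \<tau>. prefix \<sigma> \<tau> \<longrightarrow> g \<sigma> \<subseteq> g \<tau>"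
          and g_onto: "\<forall>\<sigma>. \<forall>v\<in>W. g \<sigma> \<subseteq> v \<longrightarrow> (\<exists>\<tau>. prefix \<sigma> \<tau> \<and> g \<tau> = v)"
        by (elim exE conjE)
      \<comment> \<open>pull the valuation back along the composite of the two p-morphisms\<close>
      define U where "U n = - P \<union> {\<phi> \<in> P. g (f \<phi>) \<in> V n}" for n
      have "forces P pfun_enum_le U (d []) A \<longleftrightarrow> forces W (\<subseteq>) V (g (f (d []))) A"
      proof (rule forces_p_morphism)
        show "g (f \<phi>) \<in> W" for \<phi>
          using g(2) by blast
        show "g (f \<phi>) \<subseteq> g (f \<psi>)" if "\<psi> \<in> P" "pfun_enum_le \<phi> \<psi>" for \<phi> \<psi>
          using g(3) f_mono[OF that] by blast
        show "\<exists>\<psi>\<in>P. pfun_enum_le \<phi> \<psi> \<and> g (f \<psi>) = v" if v: "\<phi> \<in> P" "v \<in> W" "g (f \<phi>) \<subseteq> v" for \<phi> v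
        proof -
          obtain \<tau> where "prefix (f \<phi>) \<tau>" "g \<tau> = v"
            using g_onto v(2,3) by blast
          then show ?thesis
            using f_onto[OF v(1)] dP f_d by (intro bexI[of _ "d \<tau>"]) auto
        qed
      qed (use dP in \<open>simp_all add: U_def\<close>)
      moreover have "- P \<subseteq> U n \<and> pfun_upset (U n)" for n
      proof -
        have "\<psi> \<in> U n" if "\<phi> \<in> P" "g (f \<phi>) \<in> V n" "pfun_enum_le \<phi> \<psi>" for \<phi> \<psi>
        proof (cases "\<psi> \<in> P")
          case True
          then have "g (f \<phi>) \<subseteq> g (f \<psi>)"
            using g(3) f_mono that(3) by blast
          then have "g (f \<psi>) \<in> V n"
            using kripke_model.persistent[OF W(3)] g(2) that(2) by (metis range_subsetD)
          with True show ?thesis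
            unfolding U_def by blast
        qed (simp add: U_def)
        moreover have "\<psi> \<in> U n" if "\<phi> \<notin> P" "pfun_enum_le \<phi> \<psi>" for \<phi> \<psi>
          using that up unfolding U_def by blast
        ultimately show ?thesis
          unfolding U_def by blast
      qed
      moreover have "forces W (\<subseteq>) V (g (f (d []))) A \<longleftrightarrow> False"
        using W(4) by (simp add: f_d g(1))
      ultimately show False
        using A dP[of "[]"] unfolding Th_eq_forced by auto
    qed
  qed
  moreover have "upset_class (- P) \<noteq> \<bottom>\<^bsub>M_Dw\<^esub>"
    using \<open>- P \<noteq> UNIV\<close> upward_of_upset[OF up] unfolding bottom_M_Dw upset_class_def by blast
  moreover have "upset_class (- P) \<in> carrier M_Dw"
    unfolding carrier_M_Dw using up by blast
  moreover have "brouwer_algebra ?L"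
    using \<open>- P \<noteq> UNIV\<close> by (rule brouwer_algebra_L)
  ultimately show ?thesis
    by blast
qed

end
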